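(* Let $1\le k\le n$, let $e_1,\dots,e_n$ be a basis of $\mathbb{R}^n$, and let $\Pi$ be the set of $k$-tuples $\alpha=(i_1,\dots,i_k)$ with $1\le i_1<\dots<i_k\le n$. Use the coordinates $q_{\alpha,\beta}$ ($\alpha\ge\beta$ in $\Pi$) on $S^2(\wedge^k\mathbb{R}^n)$, i.e. $u=\sum_{\alpha\ge\beta}q_{\alpha,\beta}\,e_\alpha\vee e_\beta$. Then the Grassmann variety $G_{n,k}$ of $k$-dimensional subspaces of $\mathbb{R}^n$ is represented, via $L(x_1,\dots,x_k)\mapsto[(x_1\wedge\dots\wedge x_k)^2]$ (where $L(x_1,\dots,x_k)$ is the span of linearly independent $x_1,\dots,x_k$), as the algebraic variety in the projective space $P(S^2(\wedge^k\mathbb{R}^n))$ consisting of exactly the points whose coordinates satisfy the following relations. (i) For every $s$ with $2\le s\le k$, every subset $I\subseteq\{1,\dots,n\}$ with $|I|=k-s$, and every $j_1<j_2<\dots<j_{2s}$ in $\{1,\dots,n\}\setminus I$, the relations $$[j_1\,j_2\,l_1\dots l_{s-3}]_I\quad (l_1<\dots<l_{s-3}\ \text{in}\ \{j_3,\dots,j_{2s}\}),$$ $$[j_1\,j_3\,l_1\dots l_{s-3}]_I\quad (l_1<\dots<l_{s-3}\ \text{in}\ \{j_4,\dots,j_{2s}\}),$$ $$[j_2\,l_1\dots l_{s-2}]_I\quad (l_1<\dots<l_{s-2}\ \text{in}\ \{j_4,\dots,j_{2s}\})$$ (for $s=2$ only the single relation $[j_2]_I$ of the third kind is present). (ii) $q_{\alpha,\beta}^2-4q_{\alpha,\alpha}q_{\beta,\beta}=0$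 for all distinct $\alpha,\beta\in\Pi$. (iii) $q_{\alpha,\beta}q_{\alpha,\gamma}-2q_{\alpha,\alpha}q_{\beta,\gamma}=0$ for all pairwise distinct $\alpha,\beta,\gamma\in\Pi$. That is, the map $L(x_1,\dots,x_k)\mapsto[(x_1\wedge\dots\wedge x_k)^2]$ is a bijection from $G_{n,k}$ onto the variety of points of $P(S^2(\wedge^k\mathbb{R}^n))$ satisfying (i), (ii) and (iii). Moreover, the relations (i) are linear, and the left-hand sides of (ii) and (iii) are quadratic forms in the coordinates of rank $3$ and rank $4$, respectively.
   Context: For $\alpha=(i_1,\dots,i_k)$ write $e_\alpha=e_{i_1}\wedge\dots\wedge e_{i_k}$; the $e_\alpha$, $\alpha\in\Pi$, form a basis of $\wedge^k\mathbb{R}^n$, ordered lexicographically starting from $e_1>e_2>\dots>e_n$, and this gives the order on $\Pi$. The vectors $e_\alpha\vee e_\beta$ with $\alpha\ge\beta$ form a basis of the symmetric square $S^2(\wedge^k\mathbb{R}^n)$; $w^2=w\vee w$ for $w\in\wedge^k\mathbb{R}^n$. $[u]$ denotes the point of the projective space determined by a nonzero vector $u$. The rank of a quadratic form is the rank of its symmetric matrix. Conventions for the coordinates: $q_{\alpha,\beta}=q_{\beta,\alpha}$, and $q_{\alpha,\beta}$ is extended to arbitrary $k$-tuples $\alpha,\beta$ of pairwise distinct indices so as to be alternating in the entries of $\alpha$ and in the entries of $\beta$. Notation $[\,\cdot\,]_I$: fix $I$ with $|I|=k-s$, listed in increasing order, and $j_1<\dots<j_{2s}$ outside $I$. Given $s-1$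 pairwise distinct elements $p_1,\dots,p_{s-1}$ of $\{j_1,\dots,j_{2s}\}$, let $t_1<\dots<t_{s+1}$ be the remaining elements of $\{j_1,\dots,j_{2s}\}$. Then $[p_1\dots p_{s-1}]_I$ denotes the relation $$\sum_{r=1}^{s+1}(-1)^r\,q_{(I,\,t_1,\dots,\widehat{t_r},\dots,t_{s+1}),\,(I,\,t_r,\,p_1,\dots,p_{s-1})}=0,$$ where the hat means omission and $(I,\dots)$ means the tuple beginning with the elements of $I$. *)

theory Defs
  imports "HOL-Analysis.Analysis" "HOL-Library.Function_Algebras"
begin

text \<open>
  The exterior power and the symmetric square are modelled as spaces of functionals, hence the
  pointwise vector space structure on functions.
\<close>

instantiation "fun" :: (type, real_vector) real_vector
begin

definition scaleR_fun :: "real \<Rightarrow> ('a \<Rightarrow> 'b) \<Rightarrow> 'a \<Rightarrow> 'b" where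
  "scaleR_fun c f = (\<lambda>x. c *\<^sub>R f x)"

instance
  by standard (auto simp: scaleR_fun_def plus_fun_def scaleR_add_right scaleR_add_left)

end


section \<open>Exterior power and symmetric square\<close>

definition alternating_forms :: "nat \<Rightarrow> ('v::real_vector list \<Rightarrow> real) set" where
  "alternating_forms k =
     {f. (\<forall>xs i. length xs = k \<longrightarrow> i < k \<longrightarrow> linear (\<lambda>v. f (xs[i := v]))) \<and>
         (\<forall>xs. length xs = k \<longrightarrow> \<not> distinct xs \<longrightarrow> f xs = 0)}"

text \<open>
  The \<open>k\<close>-th exterior power of a finite-dimensional space is the dual of its space of
  alternating \<open>k\<close>-linear forms; the product of \<open>x\<^sub>1, \<dots>, x\<^sub>k\<close> is evaluation at
  \<open>(x\<^sub>1, \<dots>, x\<^sub>k)\<close>. Functionals are cut off to \<open>0\<close> outside the space of forms.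
\<close>

definition wedge :: "'v::real_vector list \<Rightarrow> ('v list \<Rightarrow> real) \<Rightarrow> real" where
  "wedge xs = (\<lambda>f. if f \<in> alternating_forms (length xs) then f xs else 0)"

definition ext_power :: "nat \<Rightarrow> (('v::real_vector list \<Rightarrow> real) \<Rightarrow> real) set" where
  "ext_power k = span {wedge xs | xs. length xs = k}"

text \<open>
  In the same way, \<open>vee u v\<close> is evaluation of symmetric bilinear forms at \<open>(u, v)\<close>. The forms
  live on the whole type \<open>'w\<close>; since every symmetric bilinear form on a subspace \<open>W\<close> extends to
  \<open>'w\<close>, the span of the \<open>vee u v\<close> with \<open>u, v \<in> W\<close> is the symmetric square of \<open>W\<close>.
\<close>

definition vee :: "'w::real_vector \<Rightarrow> 'w \<Rightarrow> ('w \<Rightarrow> 'w \<Rightarrow> real) \<Rightarrow> real" where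
  "vee u v = (\<lambda>B. if bilinear B \<and> (\<forall>x y. B x y = B y x) then B u v else 0)"

definition sym_square :: "'w::real_vector set \<Rightarrow> (('w \<Rightarrow> 'w \<Rightarrow> real) \<Rightarrow> real) set" where
  "sym_square W = span {vee u v | u v. u \<in> W \<and> v \<in> W}"


section \<open>Projective space and Grassmannian\<close>

definition proj_point :: "'w::real_vector \<Rightarrow> 'w set" where
  "proj_point u = span {u}"

definition proj_space :: "'w::real_vector set \<Rightarrow> 'w set set" where
  "proj_space S = {proj_point u | u. u \<in> S \<and> u \<noteq> 0}"

definition grassmannian :: "nat \<Rightarrow> 'v::real_vector set set" where
  "grassmannian k = {U. subspace U \<and> dim U = k}"


section \<open>Coordinates\<close>

definition index_tuples :: "nat \<Rightarrow> nat \<Rightarrow> nat list set" where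
  "index_tuples n k = {\<alpha>. length \<alpha> = k \<and> sorted_wrt (<) \<alpha> \<and> set \<alpha> \<subseteq> {1..n}}"

text \<open>
  As \<open>e 1 > e 2 > \<dots>\<close>, the larger of two tuples of equal length is the one with the smaller entry
  at the first place where they differ.
\<close>

definition tuple_ge :: "nat list \<Rightarrow> nat list \<Rightarrow> bool" where
  "tuple_ge \<alpha> \<beta> \<longleftrightarrow> \<alpha> = \<beta> \<or> (\<alpha>, \<beta>) \<in> lex less_than"

definition coord_indices :: "nat \<Rightarrow> nat \<Rightarrow> (nat list \<times> nat list) set" where
  "coord_indices n k =
     {(\<alpha>, \<beta>). \<alpha> \<in> index_tuples n k \<and> \<beta> \<in> index_tuples n k \<and> tuple_ge \<alpha> \<beta>}"

definition e_tuple ::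
    "(nat \<Rightarrow> 'v::real_vector) \<Rightarrow> nat list \<Rightarrow> ('v list \<Rightarrow> real) \<Rightarrow> real" where
  "e_tuple e \<alpha> = wedge (map e \<alpha>)"

definition vector_of_coords ::
    "(nat \<Rightarrow> 'v::real_vector) \<Rightarrow> nat \<Rightarrow> nat \<Rightarrow> (nat list \<times> nat list \<Rightarrow> real) \<Rightarrow>
     ((('v list \<Rightarrow> real) \<Rightarrow> real) \<Rightarrow> (('v list \<Rightarrow> real) \<Rightarrow> real) \<Rightarrow> real) \<Rightarrow> real" where
  "vector_of_coords e n k q =
     (\<Sum>(\<alpha>, \<beta>)\<in>coord_indices n k. q (\<alpha>, \<beta>) *\<^sub>R vee (e_tuple e \<alpha>) (e_tuple e \<beta>))"

text \<open>
  The sign of the permutation that sorts a tuple of pairwise distinct indices (a factor \<open>-1\<close> for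
  each inversion); it is \<open>0\<close> if an index is repeated.
\<close>

definition tuple_sign :: "nat list \<Rightarrow> real" where
  "tuple_sign \<alpha> = (\<Prod>j<length \<alpha>. \<Prod>i<j. sgn (real (\<alpha> ! j) - real (\<alpha> ! i)))"

text \<open>
  \<open>qc q \<alpha> \<beta>\<close> extends the coordinates \<open>q (\<alpha>, \<beta>)\<close>, \<open>(\<alpha>, \<beta>) \<in> coord_indices n k\<close>, symmetrically to
  all pairs of increasing tuples, and then to arbitrary tuples so as to be alternating in the
  entries of \<open>\<alpha>\<close> and in those of \<open>\<beta>\<close>.
\<close>

definition qc :: "(nat list \<times> nat list \<Rightarrow> real) \<Rightarrow> nat list \<Rightarrow> nat list \<Rightarrow> real" where
  "qc q \<alpha> \<beta> = tuple_sign \<alpha> * tuple_sign \<beta> *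
     (if tuple_ge (sort \<alpha>) (sort \<beta>) then q (sort \<alpha>, sort \<beta>) else q (sort \<beta>, sort \<alpha>))"


section \<open>The relations\<close>

text \<open>The left-hand side of \<open>[p\<^sub>1 \<dots> p\<^bsub>s-1\<^esub>]\<^sub>I\<close>, where \<open>js\<close> lists \<open>j\<^sub>1 < \<dots> < j\<^bsub>2s\<^esub>\<close>.\<close>

definition bracket ::
    "(nat list \<times> nat list \<Rightarrow> real) \<Rightarrow> nat set \<Rightarrow> nat list \<Rightarrow> nat list \<Rightarrow> real" where
  "bracket q I js ps =
     (let is = sorted_list_of_set I; ts = filter (\<lambda>t. t \<notin> set ps) js in
      \<Sum>r=1..length ts. (-1) ^ r *
        qc q (is @ take (r - 1) ts @ drop r ts) (is @ [ts ! (r - 1)] @ ps))"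

definition increasing_in :: "nat set \<Rightarrow> nat \<Rightarrow> nat list set" where
  "increasing_in A m = {ls. length ls = m \<and> sorted_wrt (<) ls \<and> set ls \<subseteq> A}"

text \<open>
  Lists are indexed from \<open>0\<close>, so \<open>js ! 0\<close> is \<open>j\<^sub>1\<close>, and \<open>drop 2 js\<close> is \<open>j\<^sub>3, \<dots>, j\<^bsub>2s\<^esub>\<close>. The guard
  \<open>3 \<le> s\<close> is needed because \<open>s - 3\<close> is truncated subtraction.
\<close>

definition bracket_args :: "nat \<Rightarrow> nat list \<Rightarrow> nat list set" where
  "bracket_args s js =
     {[js ! 0, js ! 1] @ ls | ls. 3 \<le> s \<and> ls \<in> increasing_in (set (drop 2 js)) (s - 3)} \<union>
     {[js ! 0, js ! 2] @ ls | ls. 3 \<le> s \<and> ls \<in> increasing_in (set (drop 3 js)) (s - 3)} \<union>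
     {[js ! 1] @ ls | ls. 2 \<le> s \<and> ls \<in> increasing_in (set (drop 3 js)) (s - 2)}"

definition bracket_relations :: "nat \<Rightarrow> nat \<Rightarrow> (nat set \<times> nat list \<times> nat list) set" where
  "bracket_relations n k =
     {(I, js, ps). \<exists>s. 2 \<le> s \<and> s \<le> k \<and> I \<subseteq> {1..n} \<and> card I = k - s \<and>
        js \<in> increasing_in ({1..n} - I) (2 * s) \<and> ps \<in> bracket_args s js}"

definition square_relation ::
    "nat list \<Rightarrow> nat list \<Rightarrow> (nat list \<times> nat list \<Rightarrow> real) \<Rightarrow> real" where
  "square_relation \<alpha> \<beta> q = (qc q \<alpha> \<beta>)\<^sup>2 - 4 * qc q \<alpha> \<alpha> * qc q \<beta> \<beta>"

definition mixed_relation ::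
    "nat list \<Rightarrow> nat list \<Rightarrow> nat list \<Rightarrow> (nat list \<times> nat list \<Rightarrow> real) \<Rightarrow> real" where
  "mixed_relation \<alpha> \<beta> \<gamma> q = qc q \<alpha> \<beta> * qc q \<alpha> \<gamma> - 2 * qc q \<alpha> \<alpha> * qc q \<beta> \<gamma>"

definition satisfies_relations :: "nat \<Rightarrow> nat \<Rightarrow> (nat list \<times> nat list \<Rightarrow> real) \<Rightarrow> bool" where
  "satisfies_relations n k q \<longleftrightarrow>
     (\<forall>(I, js, ps)\<in>bracket_relations n k. bracket q I js ps = 0) \<and>
     (\<forall>\<alpha>\<in>index_tuples n k. \<forall>\<beta>\<in>index_tuples n k. \<alpha> \<noteq> \<beta> \<longrightarrow> square_relation \<alpha> \<beta> q = 0) \<and>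
     (\<forall>\<alpha>\<in>index_tuples n k. \<forall>\<beta>\<in>index_tuples n k. \<forall>\<gamma>\<in>index_tuples n k.
        \<alpha> \<noteq> \<beta> \<and> \<alpha> \<noteq> \<gamma> \<and> \<beta> \<noteq> \<gamma> \<longrightarrow> mixed_relation \<alpha> \<beta> \<gamma> q = 0)"

definition relation_variety ::
    "(nat \<Rightarrow> 'v::real_vector) \<Rightarrow> nat \<Rightarrow> nat \<Rightarrow>
     (((('v list \<Rightarrow> real) \<Rightarrow> real) \<Rightarrow> (('v list \<Rightarrow> real) \<Rightarrow> real) \<Rightarrow> real) \<Rightarrow> real) set set" where
  "relation_variety e n k =
     {p \<in> proj_space (sym_square (ext_power k)).
        \<exists>q. p = proj_point (vector_of_coords e n k q) \<and> satisfies_relations n k q}"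


section \<open>Linear and quadratic forms in finitely many coordinates\<close>

definition is_linear_form :: "'i set \<Rightarrow> (('i \<Rightarrow> real) \<Rightarrow> real) \<Rightarrow> bool" where
  "is_linear_form P F \<longleftrightarrow> (\<exists>c. \<forall>q. F q = (\<Sum>i\<in>P. c i * q i))"

definition is_symmetric_matrix_of ::
    "'i set \<Rightarrow> ('i \<Rightarrow> 'i \<Rightarrow> real) \<Rightarrow> (('i \<Rightarrow> real) \<Rightarrow> real) \<Rightarrow> bool" where
  "is_symmetric_matrix_of P A F \<longleftrightarrow>
     (\<forall>i\<in>P. \<forall>j\<in>P. A i j = A j i) \<and>
     (\<forall>q. F q = (\<Sum>i\<in>P. \<Sum>j\<in>P. A i j * q i * q j))"

text \<open>Row rank; rows are functions supported on \<open>P\<close>.\<close>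

definition rank_on :: "'i set \<Rightarrow> ('i \<Rightarrow> 'i \<Rightarrow> real) \<Rightarrow> nat" where
  "rank_on P A = dim ((\<lambda>i j. if j \<in> P then A i j else 0) ` P)"

definition is_quadratic_form_of_rank ::
    "'i set \<Rightarrow> (('i \<Rightarrow> real) \<Rightarrow> real) \<Rightarrow> nat \<Rightarrow> bool" where
  "is_quadratic_form_of_rank P F r \<longleftrightarrow>
     (\<exists>A. is_symmetric_matrix_of P A F \<and> rank_on P A = r)"

end

theory Submission
  imports Defs "Jordan_Normal_Form.Determinant"
begin

text \<open>
  If \<open>w = x\<^sub>1 \<and> \<dots> \<and> x\<^sub>k\<close> has coordinates \<open>p \<alpha>\<close> (minors), then \<open>w\<^sup>2\<close> has coordinates
  \<open>q \<alpha> \<alpha> = (p \<alpha>)\<^sup>2\<close> and \<open>q \<alpha> \<beta> = 2 * p \<alpha> * p \<beta>\<close>; the two tuples in each term of a relation (i) have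
  different entries, so (i) becomes a quadratic Pluecker relation between minors.
  Conversely, (ii) and (iii) force \<open>q\<close> to be, up to a nonzero factor, of this shape for some \<open>p\<close>
  with \<open>p \<alpha> = 1\<close> for some \<open>\<alpha>\<close>. The vectors \<open>x\<^sub>i = \<Sum>\<^sub>j p (\<alpha>[i := j]) e\<^sub>j\<close> have the minors \<open>p \<beta>\<close> for all
  \<open>\<beta>\<close> that differ from \<open>\<alpha>\<close> in at most one element. If \<open>\<beta>\<close> differs from \<open>\<alpha>\<close> in \<open>s \<ge> 2\<close> elements, then
  \<open>p \<alpha> * p \<beta>\<close> is, up to sign, a term of one of the listed relations, whose other terms only
  involve tuples closer to \<open>\<alpha>\<close>; so, by induction on \<open>s\<close>, \<open>p\<close> is the vector of minors of
  \<open>x\<^sub>1, \<dots>, x\<^sub>k\<close>.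
\<close>

section \<open>Signs of tuples\<close>

lemma tuple_sign_Nil [simp]: "tuple_sign [] = 1"
  by (simp add: tuple_sign_def)

lemma tuple_sign_snoc:
  "tuple_sign (xs @ [x]) = tuple_sign xs * (\<Prod>i<length xs. sgn (real x - real (xs ! i)))"
  by (simp add: tuple_sign_def nth_append)

text \<open>Makes visible that a product over positions depends only on the multiset of entries,
  hence is unchanged when two of them are swapped.\<close>

lemma prod_nth_mset:
  "(\<Prod>i<length xs. g (xs ! i)) = prod_mset (image_mset g (mset xs))"
  for g :: "'a \<Rightarrow> real"
proof (induction xs rule: rev_induct)
  case (snoc x xs)
  then show ?case by (simp add: nth_append)
qed simp

text \<open>Induction from the right: swapping the two last entries negates exactly one factor, and
  every entry appended later contributes a product over the multiset of its predecessors, which the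
  swap preserves.\<close>

lemma tuple_sign_swap:
  "tuple_sign (xs @ a # b # zs) = - tuple_sign (xs @ b # a # zs)"
proof (induction zs rule: rev_induct)
  case Nil
  have "tuple_sign ((xs @ [a]) @ [b]) = - tuple_sign ((xs @ [b]) @ [a])"
    unfolding tuple_sign_snoc
    using sgn_minus[of "real a - real b"] by (simp add: nth_append cong: prod.cong_simp)
  then show ?case by simp
next
  case (snoc z zs)
  have "(\<Prod>i<length (xs @ a # b # zs). sgn (real z - real ((xs @ a # b # zs) ! i)))
      = (\<Prod>i<length (xs @ b # a # zs). sgn (real z - real ((xs @ b # a # zs) ! i)))"
    unfolding prod_nth_mset[where g = "\<lambda>y. sgn (real z - real y)"]
    by (simp add: add_mset_commute)
  then show ?case
    using snoc tuple_sign_snoc[of "xs @ a # b # zs" z] tuple_sign_snoc[of "xs @ b # a # zs" z]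
    by simp
qed

lemma tuple_sign_eq_0_iff: "tuple_sign xs = 0 \<longleftrightarrow> \<not> distinct xs"
proof -
  have "tuple_sign xs = 0 \<longleftrightarrow> (\<exists>j\<in>{..<length xs}. \<exists>i\<in>{..<j}. xs ! j = xs ! i)"
    unfolding tuple_sign_def by (simp add: sgn_0_0)
  also have "\<dots> \<longleftrightarrow> \<not> distinct xs"
  proof
    assume "\<exists>j\<in>{..<length xs}. \<exists>i\<in>{..<j}. xs ! j = xs ! i"
    then obtain i j where "j < length xs" "i < j" "xs ! j = xs ! i" by auto
    then show "\<not> distinct xs"
      using nth_eq_iff_index_eq[of xs j i] by auto
  next
    assume "\<not> distinct xs"
    then obtain i j where ij: "i < length xs" "j < length xs" "i \<noteq> j" "xs ! i = xs ! j"
      by (auto simp: distinct_conv_nth)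
    then have "i < j \<or> j < i" by auto
    then show "\<exists>j\<in>{..<length xs}. \<exists>i\<in>{..<j}. xs ! j = xs ! i"
    proof
      assume "i < j" then show ?thesis using ij by (intro bexI[of _ j] bexI[of _ i]) auto
    next
      assume "j < i" then show ?thesis using ij by (intro bexI[of _ i] bexI[of _ j]) auto
    qed
  qed
  finally show ?thesis .
qed

lemma tuple_sign_increasing: "sorted_wrt (<) xs \<Longrightarrow> tuple_sign xs = 1"
proof (induction xs rule: rev_induct)
  case (snoc x xs)
  have "(\<Prod>i<length xs. sgn (real x - real (xs ! i))) = 1"
    using snoc.prems by (intro prod.neutral) (auto simp: sorted_wrt_append)
  then show ?case using snoc by (simp add: tuple_sign_snoc sorted_wrt_append)
qed simp

lemma sorted_wrt_less_iff: "sorted_wrt (<) xs \<longleftrightarrow> sorted xs \<and> distinct xs"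
  for xs :: "nat list"
  using strict_sorted_iff by blast

lemma increasing_unique:
  "sorted_wrt (<) xs \<Longrightarrow> sorted_wrt (<) ys \<Longrightarrow> set xs = set ys \<Longrightarrow> xs = ys"
  for xs ys :: "nat list"
  by (simp add: sorted_distinct_set_unique sorted_wrt_less_iff)

lemma not_increasing_descent:
  fixes xs :: "nat list"
  assumes "\<not> sorted xs"
  shows "\<exists>ys a b zs. xs = ys @ a # b # zs \<and> b < a"
proof -
  obtain i where i: "Suc i < length xs" "xs ! Suc i < xs ! i"
    using assms by (auto simp: sorted_iff_nth_Suc not_le)
  have "xs = take i xs @ xs ! i # xs ! Suc i # drop (Suc (Suc i)) xs"
    using i(1) by (metis Cons_nth_drop_Suc Suc_lessD append_take_drop_id)
  then show ?thesis using i(2) by blast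
qed

text \<open>Bubble sort as a well-founded induction: swapping an adjacent descent makes the tuple
  lexicographically smaller, keeps its sorted form, and negates both \<open>G\<close> and the sign.
  On a sorted tuple either an entry repeats and both sides vanish, or the sign is 1.\<close>

lemma alternating_on_tuples:
  fixes G :: "nat list \<Rightarrow> real"
  assumes nd: "\<And>xs. length xs = m \<Longrightarrow> set xs \<subseteq> A \<Longrightarrow> \<not> distinct xs \<Longrightarrow> G xs = 0"
    and swap: "\<And>xs a b zs. length (xs @ a # b # zs) = m \<Longrightarrow> set (xs @ a # b # zs) \<subseteq> A \<Longrightarrow>
                  G (xs @ a # b # zs) = - G (xs @ b # a # zs)"
  shows "length \<alpha> = m \<Longrightarrow> set \<alpha> \<subseteq> A \<Longrightarrow> G \<alpha> = tuple_sign \<alpha> * G (sort \<alpha>)"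
proof (induction \<alpha> rule: wf_induct_rule[OF wf_lex[OF wf_less_than]])
  case (1 \<alpha>)
  show ?case
  proof (cases "sorted \<alpha>")
    case True
    then show ?thesis
      using nd[OF 1(2,3)] tuple_sign_eq_0_iff tuple_sign_increasing[of \<alpha>]
      by (cases "distinct \<alpha>") (auto simp: sorted_wrt_less_iff sorted_sort_id)
  next
    case False
    then obtain xs a b zs where s: "\<alpha> = xs @ a # b # zs" "b < a"
      using not_increasing_descent by blast
    let ?\<beta> = "xs @ b # a # zs"
    have "(?\<beta>, \<alpha>) \<in> lex less_than"
      using s by (auto simp: lex_conv)
    then have "G ?\<beta> = tuple_sign ?\<beta> * G (sort ?\<beta>)"
      using 1 s by auto
    moreover have "sort ?\<beta> = sort \<alpha>"
      using s by (intro properties_for_sort) (simp_all add: add_mset_commute)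
    moreover have "G \<alpha> = - G ?\<beta>" using swap[of xs a b zs] 1(2,3) s by simp
    ultimately show ?thesis using tuple_sign_swap[of xs a b zs] s by simp
  qed
qed

section \<open>Alternating forms and minors\<close>

text \<open>A slot is written as a splitting \<open>xs @ v # ys\<close> rather than a list update;
  this form suits the inductions over tuples.\<close>

lemma alternating_linear:
  assumes "f \<in> alternating_forms k" "Suc (length xs + length ys) = k"
  shows "linear (\<lambda>v. f (xs @ v # ys))"
proof -
  have "linear (\<lambda>v. f ((xs @ 0 # ys)[length xs := v]))"
  proof -
    have "length (xs @ 0 # ys) = k" "length xs < k" using assms(2) by auto
    then show ?thesis using assms(1) unfolding alternating_forms_def by blast
  qed
  then show ?thesis by simp
qed

lemma alternating_not_distinct:
  "f \<in> alternating_forms k \<Longrightarrow> length xs = k \<Longrightarrow> \<not> distinct xs \<Longrightarrow> f xs = 0"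
  by (simp add: alternating_forms_def)

lemma alternating_formsI:
  assumes "\<And>xs ys. Suc (length xs + length ys) = k \<Longrightarrow> linear (\<lambda>v. f (xs @ v # ys))"
    and "\<And>xs. length xs = k \<Longrightarrow> \<not> distinct xs \<Longrightarrow> f xs = 0"
  shows "f \<in> alternating_forms k"
  unfolding alternating_forms_def
proof (intro CollectI conjI allI impI)
  fix xs :: "'a list" and i assume "length xs = k" "i < k"
  then show "linear (\<lambda>v. f (xs[i := v]))"
    using assms(1)[of "take i xs" "drop (Suc i) xs"] by (simp add: upd_conv_take_nth_drop)
qed (rule assms(2))

text \<open>Polarization: with \<open>a + b\<close> in both neighbouring slots the value vanishes,
  and so do the two terms of its expansion with equal entries.\<close>

lemma alternating_swap:
  assumes f: "f \<in> alternating_forms k" and len: "length (xs @ a # b # zs) = k"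
  shows "f (xs @ a # b # zs) = - f (xs @ b # a # zs)"
proof -
  have l1: "linear (\<lambda>v. f (xs @ v # w # zs))" for w
    using alternating_linear[OF f, of xs "w # zs"] len by simp
  have l2: "linear (\<lambda>v. f (xs @ w # v # zs))" for w
    using alternating_linear[OF f, of "xs @ [w]" zs] len by simp
  have z: "f (xs @ v # v # zs) = 0" for v
    using len by (intro alternating_not_distinct[OF f]) auto
  have "f (xs @ (a + b) # (a + b) # zs)
      = f (xs @ a # a # zs) + f (xs @ a # b # zs) + (f (xs @ b # a # zs) + f (xs @ b # b # zs))"
    by (simp only: linear_add[OF l1] linear_add[OF l2])
  then show ?thesis by (simp add: z)
qed

lemma alternating_index:
  assumes f: "f \<in> alternating_forms (length \<alpha>)"
  shows "f (map y \<alpha>) = tuple_sign \<alpha> * f (map y (sort \<alpha>))"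
proof (rule alternating_on_tuples[where m = "length \<alpha>" and A = UNIV])
  show "f (map y xs) = 0" if "length xs = length \<alpha>" "\<not> distinct xs" for xs
    using that by (intro alternating_not_distinct[OF f]) (auto simp: distinct_map)
  show "f (map y (xs @ a # b # zs)) = - f (map y (xs @ b # a # zs))"
    if "length (xs @ a # b # zs) = length \<alpha>" for xs a b zs
    using alternating_swap[OF f, of "map y xs" "y a" "y b" "map y zs"] that by simp
qed auto

lemma sort_in_index_tuples:
  assumes "length \<alpha> = k" "set \<alpha> \<subseteq> {1..m}" "distinct \<alpha>"
  shows "sort \<alpha> \<in> index_tuples m k"
  using assms by (auto simp: index_tuples_def sorted_wrt_less_iff)

text \<open>Multilinearity reduces the claim to tuples of generators \<open>y j\<close>, and
  antisymmetry to increasing ones.\<close>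

lemma alternating_eq_0:
  assumes f: "f \<in> alternating_forms k"
    and z: "\<And>\<alpha>. \<alpha> \<in> index_tuples m k \<Longrightarrow> f (map y \<alpha>) = 0"
    and xs: "length xs = k" "set xs \<subseteq> span (y ` {1..m})"
  shows "f xs = 0"
proof -
  \<comment> \<open>Generalised for the induction: the prefix \<open>map y \<alpha>\<close> consists
    of generators already, and each step extends it by one entry, using linearity in the first slot
    of \<open>xs\<close>.\<close>
  have "f (map y \<alpha> @ xs) = 0"
    if "length \<alpha> + length xs = k" "set \<alpha> \<subseteq> {1..m}" "set xs \<subseteq> span (y ` {1..m})" for \<alpha> xs
    using that
  proof (induction xs arbitrary: \<alpha>)
    case Nil
    then have "f (map y \<alpha>) = tuple_sign \<alpha> * f (map y (sort \<alpha>))"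
      using f by (intro alternating_index) simp
    then show ?case
      using z[OF sort_in_index_tuples[of \<alpha> k m]] Nil tuple_sign_eq_0_iff[of \<alpha>]
      by (cases "distinct \<alpha>") auto
  next
    case (Cons x xs)
    have l: "linear (\<lambda>v. f (map y \<alpha> @ v # xs))"
      using Cons.prems by (intro alternating_linear[OF f]) auto
    have "f (map y \<alpha> @ v # xs) = 0" if "v \<in> y ` {1..m}" for v
    proof -
      from that obtain j where "j \<in> {1..m}" "v = y j" by auto
      then show ?thesis using Cons.IH[of "\<alpha> @ [j]"] Cons.prems by simp
    qed
    then show ?case
      using linear_eq_0_on_span[OF l, of "y ` {1..m}"] Cons.prems by auto
  qed
  from this[of "[]"] xs show ?thesis by simp
qed

lemma alternating_sum:
  fixes h :: "'a \<Rightarrow> 'v::real_vector list \<Rightarrow> real"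
  assumes "\<And>a. a \<in> S \<Longrightarrow> h a \<in> alternating_forms k"
  shows "(\<lambda>xs. \<Sum>a\<in>S. g a * h a xs) \<in> alternating_forms k"
proof (rule alternating_formsI)
  fix xs ys :: "'v list" assume "Suc (length xs + length ys) = k"
  then have "linear (\<lambda>v. h a (xs @ v # ys))" if "a \<in> S" for a
    using that assms alternating_linear by blast
  then show "linear (\<lambda>v. \<Sum>a\<in>S. g a * h a (xs @ v # ys))"
    by (intro linear_compose_sum ballI linear_compose_scale_right[where 'b = real, simplified])
next
  fix xs :: "'v list" assume "length xs = k" "\<not> distinct xs"
  then have "h a xs = 0" if "a \<in> S" for a
    using alternating_not_distinct assms that by blast
  then show "(\<Sum>a\<in>S. g a * h a xs) = 0" by simp
qed

lemma alternating_diff: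
  assumes "f \<in> alternating_forms k" "g \<in> alternating_forms k"
  shows "(\<lambda>xs. f xs - g xs) \<in> alternating_forms k"
proof (rule alternating_formsI)
  show "linear (\<lambda>v. f (xs @ v # ys) - g (xs @ v # ys))" if "Suc (length xs + length ys) = k" for xs ys
    using that assms by (intro linear_compose_sub alternating_linear)
  show "f xs - g xs = 0" if "length xs = k" "\<not> distinct xs" for xs
    using that assms by (simp add: alternating_not_distinct[where k = k])
qed

text \<open>The interior product with \<open>v\<close>. It turns a form that detects
  \<open>v\<close> outside a subspace into a form on which wedge products of the lower degree can be
  compared.\<close>

lemma alternating_contraction:
  assumes "g \<in> alternating_forms (Suc k)"
  shows "(\<lambda>xs. g (v # xs)) \<in> alternating_forms k"
proof (rule alternating_formsI)
  show "linear (\<lambda>w. g (v # xs @ w # ys))" if "Suc (length xs + length ys) = k" for xs ys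
    using alternating_linear[OF assms, of "v # xs" ys] that by simp
qed (simp add: alternating_not_distinct[OF assms])

section \<open>Minors: Laplace expansion and quadratic relations\<close>

definition minor :: "('i \<Rightarrow> 'v \<Rightarrow> real) \<Rightarrow> 'i list \<Rightarrow> 'v list \<Rightarrow> real" where
  "minor c \<alpha> xs =
     Determinant.det (Matrix.mat (length \<alpha>) (length \<alpha>) (\<lambda>(i, j). c (\<alpha> ! i) (xs ! j)))"

text \<open>Linearity in a slot is Laplace expansion along its column, whose cofactors do not see
  that column; a repeated vector gives two equal columns.\<close>

lemma minor_alternating:
  fixes c :: "'i \<Rightarrow> 'v::real_vector \<Rightarrow> real"
  assumes "\<And>i. i \<in> set \<alpha> \<Longrightarrow> linear (c i)"
  shows "minor c \<alpha> \<in> alternating_forms (length \<alpha>)"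
proof (rule alternating_formsI)
  fix xs ys :: "'v list" assume len: "Suc (length xs + length ys) = length \<alpha>"
  define M where "M v = Matrix.mat (length \<alpha>) (length \<alpha>) (\<lambda>(i, j). c (\<alpha> ! i) ((xs @ v # ys) ! j))" for v
  let ?k = "length xs"
  have md: "mat_delete (M v) i ?k = mat_delete (M 0) i ?k" for v i
    by (rule eq_matI) (auto simp: M_def mat_delete_def nth_append nth_Cons')
  have cof: "cofactor (M v) i ?k = cofactor (M 0) i ?k" for v i
    using md[of v i] by (simp add: cofactor_def)
  have eq: "minor c \<alpha> (xs @ v # ys) = (\<Sum>i<length \<alpha>. c (\<alpha> ! i) v * cofactor (M 0) i ?k)" for v
  proof -
    have "minor c \<alpha> (xs @ v # ys) = (\<Sum>i<length \<alpha>. M v $$ (i, ?k) * cofactor (M v) i ?k)"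
      unfolding minor_def M_def[symmetric] using len
      by (intro laplace_expansion_column) (auto simp: M_def)
    also have "\<dots> = (\<Sum>i<length \<alpha>. c (\<alpha> ! i) v * cofactor (M 0) i ?k)"
      using len by (intro sum.cong refl, subst cof[of v]) (simp add: M_def)
    finally show ?thesis .
  qed
  show "linear (\<lambda>v. minor c \<alpha> (xs @ v # ys))"
    unfolding eq mult.commute[of "c _ _"]
    by (intro linear_compose_sum ballI linear_compose_scale_right[where 'b = real, simplified])
       (simp add: assms)
next
  fix xs :: "'v list" assume "length xs = length \<alpha>" "\<not> distinct xs"
  then obtain i j where ij: "i < length \<alpha>" "j < length \<alpha>" "i \<noteq> j" "xs ! i = xs ! j"
    by (auto simp: distinct_conv_nth)
  show "minor c \<alpha> xs = 0"
    unfolding minor_def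
    by (rule det_identical_columns[OF _ ij(3,1,2)]) (use ij in \<open>auto intro!: eq_vecI\<close>)
qed

text \<open>Vectors and functionals exchange roles, which is why \<open>minor\<close> allows an
  arbitrary index type; antisymmetry in the vectors thereby carries over to the indices.\<close>

lemma minor_transpose:
  assumes "length xs = length \<alpha>"
  shows "minor c \<alpha> xs = minor (\<lambda>x \<phi>. \<phi> x) xs (map c \<alpha>)"
proof -
  let ?M = "Matrix.mat (length \<alpha>) (length \<alpha>) (\<lambda>(i, j). c (\<alpha> ! i) (xs ! j))"
  have "Matrix.mat (length xs) (length xs) (\<lambda>(i, j). (map c \<alpha> ! j) (xs ! i)) = transpose_mat ?M"
    by (rule eq_matI) (auto simp: assms)
  then show ?thesis
    unfolding minor_def using det_transpose[of ?M "length \<alpha>"] by simp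
qed

lemma minor_index:
  assumes "length xs = length \<alpha>"
  shows "minor c \<alpha> xs = tuple_sign \<alpha> * minor c (sort \<alpha>) xs"
proof -
  \<comment> \<open>The transposed minor is an alternating form in the functionals \<open>c i\<close>.\<close>
  have "minor (\<lambda>x \<phi>. \<phi> x) xs \<in> alternating_forms (length xs)"
    by (rule minor_alternating) (auto intro!: linearI simp: scaleR_fun_def)
  from alternating_index[OF this[unfolded assms], of c] show ?thesis
    using minor_transpose[of xs \<alpha> c] minor_transpose[of xs "sort \<alpha>" c] assms by simp
qed

lemma minor_Cons_vector:
  assumes "length \<alpha> = Suc (length xs)"
  shows "minor c \<alpha> (x # xs) =
    (\<Sum>r<length \<alpha>. (-1) ^ r * c (\<alpha> ! r) x * minor c (take r \<alpha> @ drop (Suc r) \<alpha>) xs)"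
proof -
  let ?M = "Matrix.mat (length \<alpha>) (length \<alpha>) (\<lambda>(i, j). c (\<alpha> ! i) ((x # xs) ! j))"
  have "minor c \<alpha> (x # xs) = (\<Sum>r<length \<alpha>. ?M $$ (r, 0) * cofactor ?M r 0)"
    unfolding minor_def using assms by (intro laplace_expansion_column) auto
  also have "\<dots> = (\<Sum>r<length \<alpha>. (-1) ^ r * c (\<alpha> ! r) x * minor c (take r \<alpha> @ drop (Suc r) \<alpha>) xs)"
  proof (rule sum.cong)
    fix r assume r: "r \<in> {..<length \<alpha>}"
    have "mat_delete ?M r 0 = Matrix.mat (length xs) (length xs)
        (\<lambda>(i, j). c ((take r \<alpha> @ drop (Suc r) \<alpha>) ! i) (xs ! j))"
      using assms r by (intro eq_matI) (auto simp: mat_delete_def nth_append)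
    then show "?M $$ (r, 0) * cofactor ?M r 0
        = (-1) ^ r * c (\<alpha> ! r) x * minor c (take r \<alpha> @ drop (Suc r) \<alpha>) xs"
      using assms r by (simp add: cofactor_def minor_def min_def)
  qed simp
  finally show ?thesis .
qed

text \<open>Laplace expansion along the first row, the only one in which \<open>i\<close> occurs.
  The \<open>b j\<close> are the cofactors of that row, so any index, here \<open>undefined\<close>,
  may stand in for \<open>i\<close> when they are computed.\<close>

lemma minor_Cons_index:
  assumes "length xs = Suc (length \<alpha>)"
  shows "\<exists>b. \<forall>i. minor c (i # \<alpha>) xs = (\<Sum>j<length xs. b j * c i (xs ! j))"
proof -
  define M where "M i = Matrix.mat (length xs) (length xs) (\<lambda>(l, j). c ((i # \<alpha>) ! l) (xs ! j))" for i
  have "mat_delete (M i) 0 j = mat_delete (M i') 0 j" for i i' j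
    by (rule eq_matI) (auto simp: M_def mat_delete_def)
  then have cof: "cofactor (M i) 0 j = cofactor (M undefined) 0 j" for i j
    unfolding cofactor_def by metis
  have "minor c (i # \<alpha>) xs = (\<Sum>j<length xs. cofactor (M undefined) 0 j * c i (xs ! j))" for i
  proof -
    have "minor c (i # \<alpha>) xs = Determinant.det (M i)"
      by (simp add: minor_def M_def assms)
    also have "\<dots> = (\<Sum>j<length xs. M i $$ (0, j) * cofactor (M i) 0 j)"
      using assms by (intro laplace_expansion_row) (auto simp: M_def)
    also have "\<dots> = (\<Sum>j<length xs. cofactor (M undefined) 0 j * c i (xs ! j))"
      using assms by (intro sum.cong refl, subst cof[of i]) (simp add: M_def)
    finally show ?thesis .
  qed
  then show ?thesis by blast
qed

text \<open>Expand the second factor along its first row and exchange the sums. For each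
  \<open>j\<close> the sum over \<open>r\<close> is then the expansion along the first column of the
  minor of \<open>xs ! j # xs\<close>, which has two equal columns.\<close>

lemma minor_pluecker:
  assumes U: "length U = Suc (length xs)" and V: "length xs = Suc (length V)"
  shows "(\<Sum>r<length U. (-1) ^ r * minor c (take r U @ drop (Suc r) U) xs * minor c (U ! r # V) xs) = 0"
proof -
  obtain b where b: "\<And>i. minor c (i # V) xs = (\<Sum>j<length xs. b j * c i (xs ! j))"
    using minor_Cons_index[OF V, of c] by blast
  have z: "minor c U (xs ! j # xs) = 0" if "j < length xs" for j
    unfolding minor_def
    by (rule det_identical_columns[of _ "length U" 0 "Suc j"]) (use that U in \<open>auto intro!: eq_vecI\<close>)
  have "(\<Sum>r<length U. (-1) ^ r * minor c (take r U @ drop (Suc r) U) xs * minor c (U ! r # V) xs)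
      = (\<Sum>j<length xs. b j * minor c U (xs ! j # xs))"
    unfolding b minor_Cons_vector[OF U] sum_distrib_left
    by (subst sum.swap) (simp add: mult_ac)
  also have "\<dots> = 0" using z by simp
  finally show ?thesis .
qed

text \<open>In the Leibniz formula a nonzero term needs a permutation fixing every
  \<open>l \<noteq> i\<close>; being injective it fixes \<open>i\<close> too, so only the identity
  contributes.\<close>

lemma minor_unit_rows:
  assumes "i < length \<alpha>"
    and d: "\<And>l j. l < length \<alpha> \<Longrightarrow> j < length \<alpha> \<Longrightarrow> l \<noteq> i \<Longrightarrow> c (\<alpha> ! l) (xs ! j) = of_bool (l = j)"
  shows "minor c \<alpha> xs = c (\<alpha> ! i) (xs ! i)"
proof -
  let ?n = "length \<alpha>"
  let ?M = "Matrix.mat ?n ?n (\<lambda>(i, j). c (\<alpha> ! i) (xs ! j))"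
  let ?F = "\<lambda>p. of_int (sign p) * (\<Prod>l = 0..<?n. ?M $$ (l, p l))"
  have z: "?F p = 0" if p: "p permutes {0..<?n}" "p \<noteq> id" for p
  proof -
    have "\<exists>l<?n. l \<noteq> i \<and> p l \<noteq> l"
    proof (rule ccontr)
      assume "\<not> ?thesis"
      then have *: "p l = l" if "l \<noteq> i" for l
        using that p(1) by (cases "l < ?n") (auto simp: permutes_def)
      then have "p i = i" using permutes_inj[OF p(1)] by (metis injD)
      with * have "p = id" by (metis eq_id_iff)
      with p(2) show False by simp
    qed
    then obtain l where l: "l < ?n" "l \<noteq> i" "p l \<noteq> l" by auto
    moreover have "p l < ?n" using permutes_in_image[OF p(1), of l] l by auto
    ultimately have "?M $$ (l, p l) = 0" using d[of l "p l"] by simp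
    then show ?thesis using l by (auto intro!: prod_zero)
  qed
  have "minor c \<alpha> xs = (\<Sum>p | p permutes {0..<?n}. ?F p)"
    unfolding minor_def by (rule det_def') simp
  also have "\<dots> = (\<Sum>p\<in>{id}. ?F p)"
    using z by (intro sum.mono_neutral_right) (auto simp: finite_permutations permutes_id)
  also have "\<dots> = (\<Prod>l = 0..<?n. ?M $$ (l, l))"
    by (simp only: sum.insert[OF finite.emptyI] sum.empty empty_iff not_False_eq_True
        sign_id id_apply of_int_1 mult_1 add_0_right)
  also have "\<dots> = (\<Prod>l = 0..<?n. if l = i then c (\<alpha> ! i) (xs ! i) else 1)"
    by (intro prod.cong refl) (use d in auto)
  also have "\<dots> = c (\<alpha> ! i) (xs ! i)" using assms(1) by simp
  finally show ?thesis .
qed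

section \<open>Dual functionals and nonvanishing alternating forms\<close>

lemma dual_functionals:
  fixes y :: "'i \<Rightarrow> 'v::real_vector"
  assumes "inj_on y S" "independent (y ` S)"
  shows "\<exists>c :: 'i \<Rightarrow> 'v \<Rightarrow> real. (\<forall>i. linear (c i)) \<and> (\<forall>i\<in>S. \<forall>j\<in>S. c i (y j) = of_bool (i = j))"
proof -
  have "\<exists>g :: 'v \<Rightarrow> real. linear g \<and> (\<forall>x\<in>y ` S. g x = of_bool (x = y i))" for i
    using linear_independent_extend[OF assms(2), of "\<lambda>x. of_bool (x = y i)"] by blast
  then have "\<exists>c :: 'i \<Rightarrow> 'v \<Rightarrow> real. \<forall>i. linear (c i) \<and> (\<forall>x\<in>y ` S. c i x = of_bool (x = y i))"
    by (intro choice allI)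
  then obtain c :: "'i \<Rightarrow> 'v \<Rightarrow> real"
    where "\<And>i. linear (c i)" "\<And>i x. x \<in> y ` S \<Longrightarrow> c i x = of_bool (x = y i)" by blast
  then show ?thesis using assms(1) by (intro exI[of _ c]) (auto simp: inj_on_eq_iff)
qed

lemma image_nth_lessThan: "(!) xs ` {..<length xs} = set xs"
  by (auto simp: set_conv_nth)

text \<open>The witness is the determinant of functionals dual to \<open>xs\<close>, with value 1 at
  \<open>xs\<close>. The empty tuple is treated apart because \<open>minor_unit_rows\<close> singles
  out a row.\<close>

lemma alternating_form_nonzero:
  fixes xs :: "'v::real_vector list"
  assumes "distinct xs" "independent (set xs)"
  shows "\<exists>f\<in>alternating_forms (length xs). f xs \<noteq> 0"
proof -
  have "inj_on ((!) xs) {..<length xs}" "independent ((!) xs ` {..<length xs})"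
    using assms by (auto simp: inj_on_nth image_nth_lessThan)
  from dual_functionals[OF this] obtain c :: "nat \<Rightarrow> 'v \<Rightarrow> real" where c: "\<And>i. linear (c i)"
    "\<And>i j. i < length xs \<Longrightarrow> j < length xs \<Longrightarrow> c i (xs ! j) = of_bool (i = j)" by auto
  let ?f = "minor c [0..<length xs]"
  have "?f xs = 1"
  proof (cases "length xs = 0")
    case True
    then show ?thesis by (simp add: minor_def)
  next
    case False
    then have "?f xs = c ([0..<length xs] ! 0) (xs ! 0)"
      by (intro minor_unit_rows) (auto simp: c(2))
    then show ?thesis using False c(2) by simp
  qed
  moreover have "?f \<in> alternating_forms (length xs)"
    using minor_alternating[of "[0..<length xs]" c] c(1) by simp
  ultimately show ?thesis by (metis zero_neq_one)
qed

section \<open>Coordinates of a decomposable vector and of its square\<close>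

lemma sum_fun_apply: "(\<Sum>a\<in>S. F a) x = (\<Sum>a\<in>S. F a x)"
  for F :: "'a \<Rightarrow> 'b \<Rightarrow> 'c::comm_monoid_add"
  by (induction S rule: infinite_finite_induct) (auto simp: zero_fun_def plus_fun_def)

lemma finite_index_tuples [simp]: "finite (index_tuples n k)"
  by (rule finite_subset[OF _ finite_lists_length_eq[of "{1..n}" k]]) (auto simp: index_tuples_def)

lemma index_tuplesD:
  assumes "\<alpha> \<in> index_tuples n k"
  shows "length \<alpha> = k" "set \<alpha> \<subseteq> {1..n}" "distinct \<alpha>" "sorted \<alpha>" "sort \<alpha> = \<alpha>" "tuple_sign \<alpha> = 1"
    "card (set \<alpha>) = k"
  using assms tuple_sign_increasing[of \<alpha>]
  by (auto simp: index_tuples_def sorted_wrt_less_iff sorted_sort_id distinct_card)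

lemma index_tuples_eqI:
  "\<alpha> \<in> index_tuples n k \<Longrightarrow> \<beta> \<in> index_tuples n k \<Longrightarrow> set \<alpha> = set \<beta> \<Longrightarrow> \<alpha> = \<beta>"
  unfolding index_tuples_def by (blast intro: increasing_unique)

lemma minor_zero_row:
  assumes "i \<in> set \<alpha>" "length xs = length \<alpha>" "\<And>x. x \<in> set xs \<Longrightarrow> c i x = 0"
  shows "minor c \<alpha> xs = 0"
proof -
  obtain l where l: "l < length \<alpha>" "\<alpha> ! l = i" using assms(1) by (auto simp: in_set_conv_nth)
  let ?M = "Matrix.mat (length \<alpha>) (length \<alpha>) (\<lambda>(i, j). c (\<alpha> ! i) (xs ! j))"
  have "Determinant.det ?M = (\<Sum>j<length \<alpha>. ?M $$ (l, j) * cofactor ?M l j)"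
    using l by (intro laplace_expansion_row) auto
  also have "\<dots> = 0"
    using l assms by (intro sum.neutral) auto
  finally show ?thesis by (simp add: minor_def)
qed

text \<open>For indices in \<open>{1..n}\<close>, \<open>c i\<close> is the \<open>i\<close>-th
  coordinate functional of the basis \<open>e\<close>, so the minors
  \<open>minor c \<alpha> xs\<close> are the Pluecker coordinates of \<open>xs\<close>.\<close>

locale dual_basis =
  fixes e :: "nat \<Rightarrow> 'v::real_vector" and c :: "nat \<Rightarrow> 'v \<Rightarrow> real" and n :: nat
  assumes linear_c: "linear (c i)"
    and c_e: "i \<in> {1..n} \<Longrightarrow> j \<in> {1..n} \<Longrightarrow> c i (e j) = of_bool (i = j)"
    and span_e: "span (e ` {1..n}) = UNIV"
begin

text \<open>Equal tuples give the identity matrix. Different ones have equally many entries, so some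
  index of \<open>\<alpha>\<close> is missing from \<open>\<beta>\<close> and its row is
  zero.\<close>

lemma minor_basis:
  assumes \<alpha>: "\<alpha> \<in> index_tuples n k" and \<beta>: "\<beta> \<in> index_tuples n k"
  shows "minor c \<alpha> (map e \<beta>) = of_bool (\<alpha> = \<beta>)"
proof (cases "\<alpha> = \<beta>")
  case True
  note D = index_tuplesD[OF \<alpha>]
  have d: "c (\<alpha> ! l) (map e \<alpha> ! j) = of_bool (l = j)" if "l < length \<alpha>" "j < length \<alpha>" for l j
  proof -
    have "\<alpha> ! l \<in> {1..n}" "\<alpha> ! j \<in> {1..n}" using that D(2) by (auto dest: nth_mem)
    then show ?thesis using that D(3) c_e by (simp add: nth_eq_iff_index_eq)
  qed
  have "minor c \<alpha> (map e \<alpha>) = 1"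
  proof (cases "\<alpha> = []")
    case False
    then have "minor c \<alpha> (map e \<alpha>) = c (\<alpha> ! 0) (map e \<alpha> ! 0)"
      by (intro minor_unit_rows d) auto
    then show ?thesis using d[of 0 0] False by simp
  qed (simp add: minor_def)
  then show ?thesis using True by simp
next
  case False
  have "\<not> set \<alpha> \<subseteq> set \<beta>"
    using False index_tuples_eqI[OF \<alpha> \<beta>] card_subset_eq[of "set \<beta>" "set \<alpha>"]
      index_tuplesD(7)[OF \<alpha>] index_tuplesD(7)[OF \<beta>] by auto
  then obtain i where i: "i \<in> set \<alpha>" "i \<notin> set \<beta>" by auto
  have "c i x = 0" if "x \<in> set (map e \<beta>)" for x
  proof -
    from that obtain j where "j \<in> set \<beta>" "x = e j" by auto
    moreover have "i \<in> {1..n}" "j \<in> {1..n}" 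
      using i(1) \<open>j \<in> set \<beta>\<close> index_tuplesD(2)[OF \<alpha>] index_tuplesD(2)[OF \<beta>] by blast+
    moreover have "i \<noteq> j" using i(2) \<open>j \<in> set \<beta>\<close> by blast
    ultimately show ?thesis using c_e by simp
  qed
  then have "minor c \<alpha> (map e \<beta>) = 0"
    using i(1) index_tuplesD(1)[OF \<alpha>] index_tuplesD(1)[OF \<beta>] by (intro minor_zero_row) auto
  then show ?thesis using False by simp
qed

lemma minor_form: "length \<alpha> = k \<Longrightarrow> minor c \<alpha> \<in> alternating_forms k"
  using minor_alternating[of \<alpha> c] linear_c by auto

text \<open>Both sides are alternating in \<open>xs\<close> and agree on the increasing tuples of
  basis vectors.\<close>

lemma alternating_expansion:
  assumes f: "f \<in> alternating_forms k" and xs: "length xs = k"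
  shows "f xs = (\<Sum>\<alpha>\<in>index_tuples n k. f (map e \<alpha>) * minor c \<alpha> xs)"
proof -
  let ?g = "\<lambda>xs. \<Sum>\<alpha>\<in>index_tuples n k. f (map e \<alpha>) * minor c \<alpha> xs"
  have "f xs - ?g xs = 0"
  proof (rule alternating_eq_0[where f = "\<lambda>xs. f xs - ?g xs" and k = k and m = n and y = e])
    show "(\<lambda>xs. f xs - ?g xs) \<in> alternating_forms k"
      by (intro alternating_diff alternating_sum f minor_form index_tuplesD(1))
    show "f (map e \<beta>) - ?g (map e \<beta>) = 0" if "\<beta> \<in> index_tuples n k" for \<beta>
    proof -
      have "?g (map e \<beta>) = (\<Sum>\<alpha>\<in>index_tuples n k. if \<alpha> = \<beta> then f (map e \<alpha>) else 0)"
        using that by (intro sum.cong refl) (simp add: minor_basis)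
      also have "\<dots> = f (map e \<beta>)" using that by simp
      finally show ?thesis by simp
    qed
  qed (use xs span_e in auto)
  then show ?thesis by simp
qed

text \<open>A wedge product is evaluation of forms, so this is the expansion of a form in minors,
  read with the form as the variable.\<close>

lemma wedge_expansion:
  assumes "length xs = k"
  shows "wedge xs = (\<Sum>\<alpha>\<in>index_tuples n k. minor c \<alpha> xs *\<^sub>R e_tuple e \<alpha>)"
proof
  fix f
  have "(\<Sum>\<alpha>\<in>index_tuples n k. minor c \<alpha> xs *\<^sub>R e_tuple e \<alpha>) f
     = (\<Sum>\<alpha>\<in>index_tuples n k. minor c \<alpha> xs * (if f \<in> alternating_forms k then f (map e \<alpha>) else 0))"
    unfolding sum_fun_apply
    by (intro sum.cong refl) (simp add: scaleR_fun_def e_tuple_def wedge_def index_tuplesD(1))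
  also have "\<dots> = wedge xs f"
    using alternating_expansion[of f k xs] assms by (simp add: wedge_def mult.commute)
  finally show "wedge xs f = (\<Sum>\<alpha>\<in>index_tuples n k. minor c \<alpha> xs *\<^sub>R e_tuple e \<alpha>) f" by simp
qed

end

section \<open>The order on tuples and the coordinates of a square\<close>

lemma tuple_ge_total: "length \<alpha> = length \<beta> \<Longrightarrow> tuple_ge \<alpha> \<beta> \<or> tuple_ge \<beta> \<alpha>"
proof (induction \<alpha> \<beta> rule: list_induct2)
  case (Cons x xs y ys)
  then show ?case
    by (cases x y rule: linorder_cases) (auto simp: tuple_ge_def)
qed (simp add: tuple_ge_def)

lemma tuple_ge_antisym: "tuple_ge \<alpha> \<beta> \<Longrightarrow> tuple_ge \<beta> \<alpha> \<Longrightarrow> \<alpha> = \<beta>"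
  unfolding tuple_ge_def using wf_not_sym[OF wf_lex[OF wf_less_than]] by blast

lemma tuple_ge_refl [simp]: "tuple_ge \<alpha> \<alpha>"
  by (simp add: tuple_ge_def)

text \<open>Folding along the diagonal: by totality and antisymmetry of the order, the pairs outside
  \<open>coord_indices n k\<close> are exactly the mirror images of its off-diagonal pairs, hence
  the factor 2.\<close>

lemma sum_symmetric_pairs:
  fixes F :: "nat list \<Rightarrow> nat list \<Rightarrow> 'w::real_vector"
  assumes sym: "\<And>\<alpha> \<beta>. F \<alpha> \<beta> = F \<beta> \<alpha>"
  shows "(\<Sum>\<alpha>\<in>index_tuples n k. \<Sum>\<beta>\<in>index_tuples n k. F \<alpha> \<beta>)
    = (\<Sum>(\<alpha>, \<beta>)\<in>coord_indices n k. (if \<alpha> = \<beta> then 1 else 2) *\<^sub>R F \<alpha> \<beta>)"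
proof -
  let ?P = "index_tuples n k" and ?C = "coord_indices n k"
  let ?D = "{(\<alpha>, \<beta>) \<in> ?C. \<alpha> \<noteq> \<beta>}"
  have C: "?C \<subseteq> ?P \<times> ?P" by (auto simp: coord_indices_def)
  then have finC: "finite ?C" by (rule finite_subset) simp
  have sub: "?P \<times> ?P - ?C = prod.swap ` ?D"
  proof
    show "?P \<times> ?P - ?C \<subseteq> prod.swap ` ?D"
    proof
      fix p assume p: "p \<in> ?P \<times> ?P - ?C"
      obtain \<alpha> \<beta> where ab: "p = (\<alpha>, \<beta>)" by fastforce
      have "(\<beta>, \<alpha>) \<in> ?D"
        using p ab tuple_ge_total[of \<alpha> \<beta>] index_tuplesD(1)[of _ n k]
        by (auto simp: coord_indices_def)
      then show "p \<in> prod.swap ` ?D" using ab by (intro image_eqI[of _ _ "(\<beta>, \<alpha>)"]) auto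
    qed
    show "prod.swap ` ?D \<subseteq> ?P \<times> ?P - ?C"
      using tuple_ge_antisym by (auto simp: coord_indices_def)
  qed
  have "(\<Sum>\<alpha>\<in>?P. \<Sum>\<beta>\<in>?P. F \<alpha> \<beta>) = (\<Sum>(\<alpha>, \<beta>)\<in>?P \<times> ?P. F \<alpha> \<beta>)"
    by (rule sum.cartesian_product)
  also have "\<dots> = (\<Sum>(\<alpha>, \<beta>)\<in>?P \<times> ?P - ?C. F \<alpha> \<beta>) + (\<Sum>(\<alpha>, \<beta>)\<in>?C. F \<alpha> \<beta>)"
    by (rule sum.subset_diff[OF C]) simp
  also have "(\<Sum>(\<alpha>, \<beta>)\<in>?P \<times> ?P - ?C. F \<alpha> \<beta>) = (\<Sum>(\<alpha>, \<beta>)\<in>?D. F \<alpha> \<beta>)"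
    unfolding sub by (subst sum.reindex) (auto intro!: sum.cong sym)
  also have "\<dots> = (\<Sum>(\<alpha>, \<beta>)\<in>?C. if \<alpha> = \<beta> then 0 else F \<alpha> \<beta>)"
    by (rule sum.mono_neutral_cong_left) (use finC in auto)
  also have "\<dots> + (\<Sum>(\<alpha>, \<beta>)\<in>?C. F \<alpha> \<beta>)
      = (\<Sum>(\<alpha>, \<beta>)\<in>?C. (if \<alpha> = \<beta> then 1 else 2) *\<^sub>R F \<alpha> \<beta>)"
    unfolding sum.distrib[symmetric] by (intro sum.cong refl) (auto simp: scaleR_2)
  finally show ?thesis .
qed

text \<open>The coordinates of \<open>vee w w\<close> when \<open>w\<close> has coordinates
  \<open>a\<close>; the 2 collects the equal products in the orders \<alpha>, \<beta> and \<beta>,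
  \<alpha>.\<close>

definition square_coords :: "(nat list \<Rightarrow> real) \<Rightarrow> nat list \<times> nat list \<Rightarrow> real" where
  "square_coords a = (\<lambda>(\<alpha>, \<beta>). (if \<alpha> = \<beta> then 1 else 2) * a \<alpha> * a \<beta>)"

lemma vee_sum_sum:
  "vee (\<Sum>\<alpha>\<in>S. a \<alpha> *\<^sub>R u \<alpha>) (\<Sum>\<beta>\<in>S. a \<beta> *\<^sub>R u \<beta>)
     = (\<Sum>\<alpha>\<in>S. \<Sum>\<beta>\<in>S. (a \<alpha> * a \<beta>) *\<^sub>R vee (u \<alpha>) (u \<beta>))"
proof
  fix B
  show "vee (\<Sum>\<alpha>\<in>S. a \<alpha> *\<^sub>R u \<alpha>) (\<Sum>\<beta>\<in>S. a \<beta> *\<^sub>R u \<beta>) B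
     = (\<Sum>\<alpha>\<in>S. \<Sum>\<beta>\<in>S. (a \<alpha> * a \<beta>) *\<^sub>R vee (u \<alpha>) (u \<beta>)) B"
  proof (cases "bilinear B \<and> (\<forall>x y. B x y = B y x)")
    case True
    then have "B (\<Sum>\<alpha>\<in>S. a \<alpha> *\<^sub>R u \<alpha>) (\<Sum>\<beta>\<in>S. a \<beta> *\<^sub>R u \<beta>)
        = (\<Sum>\<alpha>\<in>S. \<Sum>\<beta>\<in>S. a \<alpha> * a \<beta> * B (u \<alpha>) (u \<beta>))"
      by (simp add: bilinear_sum bilinear_lmul bilinear_rmul sum.cartesian_product mult_ac
          cong: sum.cong)
    then show ?thesis using True by (simp add: vee_def sum_fun_apply scaleR_fun_def)
  next
    case False
    then have "vee u v B = 0" for u v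
      unfolding vee_def by (rule if_not_P)
    then show ?thesis by (simp add: sum_fun_apply scaleR_fun_def)
  qed
qed

lemma vee_commute: "vee u v = vee v u"
  by (rule ext) (auto simp: vee_def)

lemma vee_square_coords:
  assumes "w = (\<Sum>\<alpha>\<in>index_tuples n k. a \<alpha> *\<^sub>R e_tuple e \<alpha>)"
  shows "vee w w = vector_of_coords e n k (square_coords a)"
proof -
  have "vee w w = (\<Sum>\<alpha>\<in>index_tuples n k. \<Sum>\<beta>\<in>index_tuples n k.
      (a \<alpha> * a \<beta>) *\<^sub>R vee (e_tuple e \<alpha>) (e_tuple e \<beta>))"
    unfolding assms by (rule vee_sum_sum)
  also have "\<dots> = vector_of_coords e n k (square_coords a)"
    unfolding vector_of_coords_def
    by (subst sum_symmetric_pairs)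
       (auto intro!: sum.cong simp: square_coords_def vee_commute mult.commute)
  finally show ?thesis .
qed

section \<open>The linear relations in terms of minors\<close>

definition alt_ext :: "(nat list \<Rightarrow> real) \<Rightarrow> nat list \<Rightarrow> real" where
  "alt_ext a \<alpha> = tuple_sign \<alpha> * a (sort \<alpha>)"

lemma alt_ext_increasing: "\<alpha> \<in> index_tuples n k \<Longrightarrow> alt_ext a \<alpha> = a \<alpha>"
  by (simp add: alt_ext_def index_tuplesD)

lemma alt_ext_minor: "length xs = length \<alpha> \<Longrightarrow> alt_ext (\<lambda>\<beta>. minor c \<beta> xs) \<alpha> = minor c \<alpha> xs"
  by (simp add: alt_ext_def minor_index[symmetric])

text \<open>Restricted to off-diagonal pairs, because for a square the constant on the diagonal is
  half of the constant \<open>K\<close> off it.\<close>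

lemma qc_symmetric_values:
  assumes sym: "\<And>\<alpha> \<beta>. \<alpha> \<in> index_tuples n k \<Longrightarrow> \<beta> \<in> index_tuples n k \<Longrightarrow> \<alpha> \<noteq> \<beta> \<Longrightarrow>
      (if tuple_ge \<alpha> \<beta> then q (\<alpha>, \<beta>) else q (\<beta>, \<alpha>)) = K * a \<alpha> * a \<beta>"
    and "length \<alpha> = k" "length \<beta> = k" "set \<alpha> \<subseteq> {1..n}" "set \<beta> \<subseteq> {1..n}" "set \<alpha> \<noteq> set \<beta>"
  shows "qc q \<alpha> \<beta> = K * alt_ext a \<alpha> * alt_ext a \<beta>"
proof (cases "distinct \<alpha> \<and> distinct \<beta>")
  case True
  then have "sort \<alpha> \<in> index_tuples n k" "sort \<beta> \<in> index_tuples n k" "sort \<alpha> \<noteq> sort \<beta>"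
    using assms sort_in_index_tuples by (blast, blast, metis set_sort)
  from sym[OF this] show ?thesis by (simp add: qc_def alt_ext_def)
next
  case False
  then show ?thesis using tuple_sign_eq_0_iff by (auto simp: qc_def alt_ext_def)
qed

text \<open>Collects the sizes and disjointness facts common to all three families of arguments, so
  that the family a relation belongs to can be forgotten.\<close>

lemma bracket_relationsD:
  assumes "(I, js, ps) \<in> bracket_relations n k"
  obtains s "is" ts where "is = sorted_list_of_set I" "ts = filter (\<lambda>t. t \<notin> set ps) js"
    "2 \<le> s" "length is + s = k" "length ts = Suc s" "Suc (length ps) = s"
    "distinct (is @ ts)" "distinct (is @ ps)" "set ts \<inter> set ps = {}"
    "set (is @ ts @ ps) \<subseteq> {1..n}"
proof -
  from assms obtain s where s: "2 \<le> s" "s \<le> k" "I \<subseteq> {1..n}" "card I = k - s"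
      "js \<in> increasing_in ({1..n} - I) (2 * s)" "ps \<in> bracket_args s js"
    unfolding bracket_relations_def by blast
  have finI: "finite I" using s(3) by (rule finite_subset) simp
  have js: "length js = 2 * s" "distinct js" "set js \<subseteq> {1..n} - I"
    using s(5) by (auto simp: increasing_in_def sorted_wrt_less_iff)
  have nin: "js ! i \<notin> set (drop m js)" if "i < m" "i < length js" for i m
    using that js(2) by (auto simp: in_set_conv_nth nth_eq_iff_index_eq)
  have ne: "js ! 0 \<noteq> js ! 1" "js ! 0 \<noteq> js ! 2"
    using js s(1) by (simp_all add: nth_eq_iff_index_eq)
  have in_js: "js ! 0 \<in> set js" "js ! 1 \<in> set js" "js ! 2 \<in> set js"
    using js s(1) by simp_all
  have n0: "js ! 0 \<notin> set (drop 2 js)" "js ! 0 \<notin> set (drop 3 js)" "js ! 1 \<notin> set (drop 2 js)"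
    "js ! 1 \<notin> set (drop 3 js)" "js ! 2 \<notin> set (drop 3 js)"
    using js s(1) by (simp_all add: nin)
  have ps: "distinct ps \<and> set ps \<subseteq> set js \<and> Suc (length ps) = s"
    using s(6) unfolding bracket_args_def
  proof (elim UnE CollectE exE conjE)
    fix ls assume "ps = [js ! 0, js ! 1] @ ls" "3 \<le> s" "ls \<in> increasing_in (set (drop 2 js)) (s - 3)"
    then show ?thesis using ne in_js n0 set_drop_subset[of 2 js]
      by (auto simp: increasing_in_def sorted_wrt_less_iff)
  next
    fix ls assume "ps = [js ! 0, js ! 2] @ ls" "3 \<le> s" "ls \<in> increasing_in (set (drop 3 js)) (s - 3)"
    then show ?thesis using ne in_js n0 set_drop_subset[of 3 js]
      by (auto simp: increasing_in_def sorted_wrt_less_iff)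
  next
    fix ls assume "ps = [js ! 1] @ ls" "2 \<le> s" "ls \<in> increasing_in (set (drop 3 js)) (s - 2)"
    then show ?thesis using ne in_js n0 set_drop_subset[of 3 js]
      by (auto simp: increasing_in_def sorted_wrt_less_iff)
  qed
  define ts where "ts = filter (\<lambda>t. t \<notin> set ps) js"
  have setts: "set ts = set js - set ps" "distinct ts" using js(2) by (auto simp: ts_def)
  have "length ts = card (set ts)" using setts(2) by (simp add: distinct_card)
  also have "\<dots> = 2 * s - length ps"
    unfolding setts(1) using ps js by (simp add: card_Diff_subset distinct_card)
  finally have "length ts = Suc s" using ps s(1) by linarith
  moreover have "length (sorted_list_of_set I) + s = k" using s(2,4) by simp
  ultimately show ?thesis
    using that[OF refl refl s(1)] ps js s(3) setts finI unfolding ts_def[symmetric] by auto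
qed

text \<open>The sum is re-indexed from 0, hence the exponent \<open>Suc r\<close>. \<open>Q\<close>
  is a parameter: whatever holds for all admissible pairs of tuples holds for the two tuples of each
  term. It is later the product form of \<open>qc\<close>, its linearity, or a list of basic facts
  about the tuples.\<close>

lemma bracket_eq_sum:
  assumes rel: "(I, js, ps) \<in> bracket_relations n k"
    and q: "\<And>\<alpha> \<beta>. length \<alpha> = k \<Longrightarrow> length \<beta> = k \<Longrightarrow> set \<alpha> \<subseteq> {1..n} \<Longrightarrow> set \<beta> \<subseteq> {1..n} \<Longrightarrow>
            set \<alpha> \<noteq> set \<beta> \<Longrightarrow> distinct \<alpha> \<Longrightarrow> distinct \<beta> \<Longrightarrow> Q \<alpha> \<beta>"
    and "is = sorted_list_of_set I" "ts = filter (\<lambda>t. t \<notin> set ps) js"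
  shows "bracket q I js ps = (\<Sum>r<length ts. (-1) ^ Suc r *
           qc q (is @ take r ts @ drop (Suc r) ts) (is @ ts ! r # ps))"
    and "\<And>r. r < length ts \<Longrightarrow> Q (is @ take r ts @ drop (Suc r) ts) (is @ ts ! r # ps)"
proof -
  show "bracket q I js ps = (\<Sum>r<length ts. (-1) ^ Suc r *
           qc q (is @ take r ts @ drop (Suc r) ts) (is @ ts ! r # ps))"
    unfolding bracket_def Let_def assms(3,4)[symmetric]
    by (rule sum.reindex_bij_witness[of _ Suc "\<lambda>r. r - 1"]) auto
next
  fix r assume r: "r < length ts"
  from rel obtain s where s: "2 \<le> s" "length is + s = k" "length ts = Suc s" "Suc (length ps) = s"
    "distinct (is @ ts)" "distinct (is @ ps)" "set ts \<inter> set ps = {}"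
    "set (is @ ts @ ps) \<subseteq> {1..n}"
    by (rule bracket_relationsD) (use assms(3,4) in blast)
  have ts: "ts = take r ts @ ts ! r # drop (Suc r) ts" using r by (simp add: id_take_nth_drop)
  have sub: "set (take r ts) \<subseteq> set ts" "set (drop (Suc r) ts) \<subseteq> set ts"
    by (rule set_take_subset set_drop_subset)+
  have d: "distinct (take r ts @ ts ! r # drop (Suc r) ts)" using s(5) ts by (metis distinct_append)
  have m: "ts ! r \<in> set ts" using r by simp
  show "Q (is @ take r ts @ drop (Suc r) ts) (is @ ts ! r # ps)"
  proof (rule q)
    \<comment> \<open>The omitted entry \<open>ts ! r\<close> occurs only in the second tuple, so no
      diagonal coordinate enters a relation (i).\<close>
    have "ts ! r \<notin> set (is @ take r ts @ drop (Suc r) ts)" using d m s(5) by auto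
    then show "set (is @ take r ts @ drop (Suc r) ts) \<noteq> set (is @ ts ! r # ps)" by auto
    show "length (is @ take r ts @ drop (Suc r) ts) = k" "length (is @ ts ! r # ps) = k"
      using s(1-4) r by simp_all
    show "set (is @ take r ts @ drop (Suc r) ts) \<subseteq> {1..n}" using s(8) sub by fastforce
    show "set (is @ ts ! r # ps) \<subseteq> {1..n}" using s(8) m by (simp add: subset_iff)
    have "set is \<inter> set ts = {}" using s(5) by simp
    then have "set is \<inter> (set (take r ts) \<union> set (drop (Suc r) ts)) = {}" using sub by blast
    then show "distinct (is @ take r ts @ drop (Suc r) ts)"
      using s(5) d by (simp add: Int_Un_distrib)
    show "distinct (is @ ts ! r # ps)"
      using s(5,6,7) m by (simp add: disjoint_iff) blast
  qed
qed

text \<open>As only off-diagonal coordinates occur, all terms share the factor \<open>K\<close>; the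
  minus sign comes from the index shift.\<close>

lemma bracket_alt_ext:
  assumes rel: "(I, js, ps) \<in> bracket_relations n k"
    and sym: "\<And>\<alpha> \<beta>. \<alpha> \<in> index_tuples n k \<Longrightarrow> \<beta> \<in> index_tuples n k \<Longrightarrow> \<alpha> \<noteq> \<beta> \<Longrightarrow>
      (if tuple_ge \<alpha> \<beta> then q (\<alpha>, \<beta>) else q (\<beta>, \<alpha>)) = K * a \<alpha> * a \<beta>"
    and "is = sorted_list_of_set I" "ts = filter (\<lambda>t. t \<notin> set ps) js"
  shows "bracket q I js ps = - K * (\<Sum>r<length ts. (-1) ^ r *
           alt_ext a (is @ take r ts @ drop (Suc r) ts) * alt_ext a (is @ ts ! r # ps))"
proof -
  note * = bracket_eq_sum[OF rel _ assms(3,4),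
    where Q = "\<lambda>\<alpha> \<beta>. qc q \<alpha> \<beta> = K * alt_ext a \<alpha> * alt_ext a \<beta>"]
  have "bracket q I js ps = (\<Sum>r<length ts. (-1) ^ Suc r *
           qc q (is @ take r ts @ drop (Suc r) ts) (is @ ts ! r # ps))"
    by (rule *(1)) (rule qc_symmetric_values[OF sym])
  also have "\<dots> = (\<Sum>r<length ts. (-1) ^ Suc r * (K *
           alt_ext a (is @ take r ts @ drop (Suc r) ts) * alt_ext a (is @ ts ! r # ps)))"
  proof (intro sum.cong refl arg_cong[where f = "\<lambda>x. _ * x"] *(2))
    show "qc q \<alpha> \<beta> = K * alt_ext a \<alpha> * alt_ext a \<beta>"
      if "length \<alpha> = k" "length \<beta> = k" "set \<alpha> \<subseteq> {1..n}" "set \<beta> \<subseteq> {1..n}" "set \<alpha> \<noteq> set \<beta>" for \<alpha> \<beta>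
      by (rule qc_symmetric_values[OF sym that])
  qed auto
  finally show ?thesis by (simp add: sum_distrib_left mult_ac flip: sum_negf)
qed

text \<open>Moving \<open>t\<close> past \<open>xs\<close> takes \<open>length xs\<close> adjacent
  swaps.\<close>

lemma tuple_sign_move: "tuple_sign (t # xs @ ps) = (-1) ^ length xs * tuple_sign (xs @ t # ps)"
proof (induction xs arbitrary: t ps rule: rev_induct)
  case (snoc x xs)
  have "tuple_sign (t # (xs @ [x]) @ ps) = (-1) ^ length xs * tuple_sign (xs @ t # x # ps)"
    using snoc[of t "x # ps"] by simp
  also have "tuple_sign (xs @ t # x # ps) = - tuple_sign (xs @ x # t # ps)"
    by (rule tuple_sign_swap)
  finally show ?case by simp
qed simp

text \<open>This is \<open>minor_pluecker\<close> for \<open>is @ ts\<close> and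
  \<open>is @ ps\<close>. Terms that exchange an index of \<open>is\<close> vanish by repetition. In
  the others, the sign of the shift by \<open>length is\<close> cancels the sign of moving
  \<open>ts ! r\<close> behind \<open>is\<close>.\<close>

lemma minor_bracket:
  assumes rel: "(I, js, ps) \<in> bracket_relations n k" and xs: "length xs = k"
    and "is = sorted_list_of_set I" "ts = filter (\<lambda>t. t \<notin> set ps) js"
  shows "(\<Sum>r<length ts. (-1) ^ r *
           minor c (is @ take r ts @ drop (Suc r) ts) xs * minor c (is @ ts ! r # ps) xs) = 0"
proof -
  from rel obtain s where s: "2 \<le> s" "length is + s = k" "length ts = Suc s" "Suc (length ps) = s"
    by (rule bracket_relationsD) (use assms(3,4) in blast)
  let ?U = "is @ ts" and ?V = "is @ ps"
  let ?f = "\<lambda>r. (-1) ^ r * minor c (take r ?U @ drop (Suc r) ?U) xs * minor c (?U ! r # ?V) xs"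
  have z: "?f r = 0" if "r < length is" for r
  proof -
    have "\<not> distinct (?U ! r # ?V)" using that by (simp add: nth_append)
    then have "tuple_sign (?U ! r # ?V) = 0" using tuple_sign_eq_0_iff by blast
    moreover have "length xs = length (?U ! r # ?V)" using s xs by simp
    ultimately show ?thesis using minor_index[of xs "?U ! r # ?V" c] by simp
  qed
  have move: "minor c (t # is @ ps) xs = (-1) ^ length is * minor c (is @ t # ps) xs" for t
  proof -
    have "sort (t # is @ ps) = sort (is @ t # ps)"
      by (intro properties_for_sort) (simp_all add: add_mset_commute)
    then show ?thesis
      using minor_index[of xs "t # is @ ps" c] minor_index[of xs "is @ t # ps" c] s xs
        tuple_sign_move[of t "is" ps] by simp
  qed
  have "0 = (\<Sum>r<length ?U. ?f r)"
    using minor_pluecker[of ?U xs ?V c] s xs by simp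
  also have "\<dots> = (\<Sum>r\<in>{length is..<length ?U}. ?f r)"
  proof (intro sum.mono_neutral_right ballI)
    fix r assume "r \<in> {..<length ?U} - {length is..<length ?U}"
    then have "r < length is" by (cases "length is \<le> r") auto
    then show "?f r = 0" by (rule z)
  qed auto
  also have "\<dots> = (\<Sum>r<length ts. ?f (r + length is))"
  proof -
    have "{length is..<length ?U} = {0 + length is..<length ts + length is}"
      by (simp add: add.commute)
    then show ?thesis by (simp only: sum.shift_bounds_nat_ivl lessThan_atLeast0)
  qed
  also have "\<dots> = (\<Sum>r<length ts. (-1) ^ r *
           minor c (is @ take r ts @ drop (Suc r) ts) xs * minor c (is @ ts ! r # ps) xs)"
    by (intro sum.cong refl) (simp add: move nth_append power_add Suc_diff_le)
  finally show ?thesis by simp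
qed

lemma satisfies_relations_minors:
  assumes xs: "length xs = k"
  shows "satisfies_relations n k (square_coords (\<lambda>\<alpha>. minor c \<alpha> xs))"
proof -
  let ?a = "\<lambda>\<alpha>. minor c \<alpha> xs"
  let ?q = "square_coords ?a"
  have val: "qc ?q \<alpha> \<beta> = (if \<alpha> = \<beta> then 1 else 2) * ?a \<alpha> * ?a \<beta>"
    if "\<alpha> \<in> index_tuples n k" "\<beta> \<in> index_tuples n k" for \<alpha> \<beta>
    using that by (simp add: qc_def index_tuplesD square_coords_def)
  have "bracket ?q I js ps = 0" if rel: "(I, js, ps) \<in> bracket_relations n k" for I js ps
  proof -
    define "is" ts where d: "is = sorted_list_of_set I" "ts = filter (\<lambda>t. t \<notin> set ps) js"
    from rel obtain s where s: "2 \<le> s" "length is + s = k" "length ts = Suc s" "Suc (length ps) = s"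
      by (rule bracket_relationsD) (use d in blast)
    \<comment> \<open>Here \<open>K = 2\<close>, the off-diagonal factor of
      \<open>square_coords\<close>.\<close>
    have "bracket ?q I js ps = - 2 * (\<Sum>r<length ts. (-1) ^ r *
           alt_ext ?a (is @ take r ts @ drop (Suc r) ts) * alt_ext ?a (is @ ts ! r # ps))"
      by (rule bracket_alt_ext[OF rel _ d]) (simp add: square_coords_def)
    also have "\<dots> = - 2 * (\<Sum>r<length ts. (-1) ^ r *
           minor c (is @ take r ts @ drop (Suc r) ts) xs * minor c (is @ ts ! r # ps) xs)"
      using s xs by (simp add: alt_ext_minor cong: sum.cong_simp)
    finally show ?thesis using minor_bracket[OF rel xs d, of c] by simp
  qed
  then show ?thesis
    unfolding satisfies_relations_def square_relation_def mixed_relation_def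
    by (auto simp: val power2_eq_square)
qed

section \<open>The relations determine a vector from its neighbouring coordinates\<close>

lemma increasing_in_sorted_list:
  assumes "finite C" "C \<subseteq> S" "card C = m"
  shows "sorted_list_of_set C \<in> increasing_in S m"
  using assms by (simp add: increasing_in_def)

text \<open>
  Every partition of the \<open>j\<close>'s into two halves occurs in a listed relation. Let \<open>X\<close> be the half
  containing \<open>j\<^sub>1\<close>. If \<open>X\<close> contains \<open>j\<^sub>2\<close> or \<open>j\<^sub>3\<close>, drop some further element of \<open>X\<close>; otherwise
  drop \<open>j\<^sub>3\<close> from the other half.
\<close>

lemma bracket_args_exchange:
  assumes s: "2 \<le> s" and js: "length js = 2 * s" "sorted_wrt (<) js"
    and part: "A \<union> B = set js" "A \<inter> B = {}" "card A = s" "card B = s"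
  shows "\<exists>ps\<in>bracket_args s js. \<exists>X Y t. ((X = A \<and> Y = B) \<or> (X = B \<and> Y = A)) \<and> t \<in> X \<and> set ps = X - {t}"
proof -
  have dist: "distinct js" using js(2) by (simp add: sorted_wrt_less_iff)
  define a b d where abd: "a = js ! 0" "b = js ! 1" "d = js ! 2"
  have ne: "a \<noteq> b" "a \<noteq> d" "b \<noteq> d"
    using js(1) s dist by (simp_all add: abd nth_eq_iff_index_eq)
  have "js = a # drop 1 js" "drop 1 js = b # drop 2 js" "drop 2 js = d # drop 3 js"
    using js(1) s Cons_nth_drop_Suc[of 0 js] Cons_nth_drop_Suc[of 1 js] Cons_nth_drop_Suc[of 2 js]
    by (simp_all add: abd numeral_3_eq_3 numeral_2_eq_2)
  then have sets: "set js = insert a (insert b (insert d (set (drop 3 js))))"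
    "set (drop 2 js) = insert d (set (drop 3 js))"
    by (metis list.simps(15))+
  have "finite (A \<union> B)" by (simp add: part(1))
  then have fin: "finite A" "finite B" by simp_all
  have "a \<in> A \<union> B" unfolding part(1) sets(1) by simp
  then obtain X Y where XY: "(X = A \<and> Y = B) \<or> (X = B \<and> Y = A)" "a \<in> X" by blast
  have U: "X \<union> Y = set js" "X \<inter> Y = {}" "card X = s" "card Y = s" "finite X" "finite Y"
    using XY(1) part fin by auto
  have drop_one: "\<exists>t. t \<in> X \<and> t \<notin> {a, x} \<and> card (X - {a, x, t}) = s - 3"
    if "3 \<le> s" "x \<in> X" "x \<noteq> a" for x
  proof -
    have "card {a, x} < card X" using that U(3) by simp
    then have "\<not> X \<subseteq> {a, x}" using card_mono[of "{a, x}" X] by auto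
    then obtain t where "t \<in> X" "t \<notin> {a, x}" by blast
    then show ?thesis
      using that XY(2) U(3,5) by (intro exI[of _ t]) (auto simp: card_Diff_subset)
  qed
  consider "b \<in> X" "3 \<le> s" | "b \<notin> X" "d \<in> X" "3 \<le> s" | "b \<notin> X" "d \<notin> X" | "s = 2" using s by linarith
  then show ?thesis
  proof cases
    case 1
    from drop_one[OF 1(2,1)] ne obtain t
      where t: "t \<in> X" "t \<notin> {a, b}" "card (X - {a, b, t}) = s - 3" by blast
    let ?ls = "sorted_list_of_set (X - {a, b, t})"
    have "X - {a, b, t} \<subseteq> set (drop 2 js)" using U(1) sets by blast
    then have "[js ! 0, js ! 1] @ ?ls \<in> bracket_args s js"
      using 1 t(3) U(5) increasing_in_sorted_list[of "X - {a, b, t}" "set (drop 2 js)" "s - 3"]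
      unfolding bracket_args_def by blast
    moreover have "set ([js ! 0, js ! 1] @ ?ls) = X - {t}"
      unfolding abd[symmetric] using U(5) XY(2) 1 t by auto
    ultimately show ?thesis using XY(1) t(1) by blast
  next
    case 2
    from drop_one[OF 2(3,2)] ne obtain t
      where t: "t \<in> X" "t \<notin> {a, d}" "card (X - {a, d, t}) = s - 3" by blast
    let ?ls = "sorted_list_of_set (X - {a, d, t})"
    have "X - {a, d, t} \<subseteq> set (drop 3 js)" using U(1) sets 2(1) by blast
    then have "[js ! 0, js ! 2] @ ?ls \<in> bracket_args s js"
      using 2 t(3) U(5) increasing_in_sorted_list[of "X - {a, d, t}" "set (drop 3 js)" "s - 3"]
      unfolding bracket_args_def by blast
    moreover have "set ([js ! 0, js ! 2] @ ?ls) = X - {t}"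
      unfolding abd[symmetric] using U(5) XY(2) 2 t by auto
    ultimately show ?thesis using XY(1) t(1) by blast
  next
    case 3
    then have bd: "b \<in> Y" "d \<in> Y" "a \<notin> Y" using U(1,2) XY(2) sets by blast+
    let ?ls = "sorted_list_of_set (Y - {b, d})"
    have "Y \<subseteq> set js" using U(1) by blast
    then have "Y - {b, d} \<subseteq> set (drop 3 js)" using bd(3) unfolding sets(1) by blast
    moreover have "card (Y - {b, d}) = s - 2" using bd ne U(4,6) by (auto simp: card_Diff_subset)
    ultimately have "[js ! 1] @ ?ls \<in> bracket_args s js"
      using s U(6) increasing_in_sorted_list[of "Y - {b, d}" "set (drop 3 js)" "s - 2"]
      unfolding bracket_args_def by blast
    moreover have "set ([js ! 1] @ ?ls) = Y - {d}"
      unfolding abd[symmetric] using U(6) bd ne by auto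
    ultimately show ?thesis using XY(1) bd(2) by blast
  next
    \<comment> \<open>For \<open>s = 2\<close> the half containing \<open>b\<close> has two
      elements, so the single list \<open>[b]\<close> is that half without its other element,
      whichever half contains \<open>a\<close>.\<close>
    case 4
    have "[] \<in> increasing_in (set (drop 3 js)) (s - 2)" using 4 by (simp add: increasing_in_def)
    then have ps: "[js ! 1] @ [] \<in> bracket_args s js" unfolding bracket_args_def using s by blast
    have "b \<in> A \<union> B" unfolding part(1) sets(1) by simp
    then obtain Z W where ZW: "(Z = A \<and> W = B) \<or> (Z = B \<and> W = A)" "b \<in> Z" by blast
    then have "card (Z - {b}) = 1" using part(3,4) fin 4 by auto
    then obtain t where t: "Z - {b} = {t}" by (rule card_1_singletonE)
    then have "t \<in> Z" "set ([js ! 1] @ []) = Z - {t}"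
      unfolding abd[symmetric] using ZW(2) by auto
    then show ?thesis using ps ZW(1) by blast
  qed
qed

text \<open>Two solutions of the same relations are compared in the relation where the values at
  \<alpha> and \<beta> are multiplied: by induction all other terms agree and cancel, and the common
  nonzero value at \<alpha> can be divided out.\<close>

lemma determined_by_neighbours:
  fixes g h :: "nat list \<Rightarrow> real"
  assumes rels: "\<And>f I js ps is ts. f \<in> {g, h} \<Longrightarrow> (I, js, ps) \<in> bracket_relations n k \<Longrightarrow>
        is = sorted_list_of_set I \<Longrightarrow> ts = filter (\<lambda>t. t \<notin> set ps) js \<Longrightarrow>
        (\<Sum>r<length ts. (-1) ^ r *
           alt_ext f (is @ take r ts @ drop (Suc r) ts) * alt_ext f (is @ ts ! r # ps)) = 0"
    and \<alpha>: "\<alpha> \<in> index_tuples n k" "g \<alpha> = h \<alpha>" "h \<alpha> \<noteq> 0"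
    and near: "\<And>\<beta>. \<beta> \<in> index_tuples n k \<Longrightarrow> card (set \<beta> - set \<alpha>) = 1 \<Longrightarrow> g \<beta> = h \<beta>"
  shows "\<beta> \<in> index_tuples n k \<Longrightarrow> g \<beta> = h \<beta>"
proof (induction "card (set \<beta> - set \<alpha>)" arbitrary: \<beta> rule: less_induct)
  case less
  note A = index_tuplesD[OF \<alpha>(1)] and B = index_tuplesD[OF less(2)]
  define s where "s = card (set \<beta> - set \<alpha>)"
  consider "s = 0" | "s = 1" | "2 \<le> s" by linarith
  then show ?case
  proof cases
    case 1
    then have "set \<beta> \<subseteq> set \<alpha>" by (simp add: s_def)
    then have "set \<beta> = set \<alpha>" using A(7) B(7) by (intro card_subset_eq) auto
    then show ?thesis using index_tuples_eqI[OF less(2) \<alpha>(1)] \<alpha>(2) by simp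
  next
    case 2
    then show ?thesis using near[OF less(2)] by (simp add: s_def)
  next
    case 3
    \<comment> \<open>The common part becomes the index set of the relation, and the two differences
      are the halves into which its \<open>j\<close>'s are partitioned.\<close>
    define I A' B' where IAB: "I = set \<alpha> \<inter> set \<beta>" "A' = set \<alpha> - set \<beta>" "B' = set \<beta> - set \<alpha>"
    have \<alpha>\<beta>: "set \<alpha> = I \<union> A'" "set \<beta> = I \<union> B'" by (auto simp: IAB)
    have disj: "I \<inter> A' = {}" "I \<inter> B' = {}" "A' \<inter> B' = {}" by (auto simp: IAB)
    have fin: "finite I" "finite A'" "finite B'" by (auto simp: IAB)
    have cB: "card B' = s" by (simp add: s_def IAB)
    have "card I + card A' = k" "card I + card B' = k"
      using A(7) B(7) card_Un_disjoint[OF fin(1,2) disj(1)] card_Un_disjoint[OF fin(1,3) disj(2)]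
      unfolding \<alpha>\<beta> by simp_all
    then have cA: "card A' = s" and cI: "card I = k - s" and "s \<le> k" using cB by auto
    have I_sub: "I \<subseteq> {1..n}" and AB_sub: "A' \<union> B' \<subseteq> {1..n} - I"
      using A(2) B(2) disj unfolding \<alpha>\<beta> by blast+
    define js where "js = sorted_list_of_set (A' \<union> B')"
    have js: "set js = A' \<union> B'" "sorted_wrt (<) js" "length js = 2 * s"
      using fin cA cB disj(3) by (simp_all add: js_def card_Un_disjoint)
    obtain ps X Y t where ps: "ps \<in> bracket_args s js" "t \<in> X" "set ps = X - {t}"
      and XY: "(X = A' \<and> Y = B') \<or> (X = B' \<and> Y = A')"
      using bracket_args_exchange[OF 3 js(3,2) js(1)[symmetric] disj(3) cA cB] by blast
    have rel: "(I, js, ps) \<in> bracket_relations n k"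
      unfolding bracket_relations_def
      using 3 \<open>s \<le> k\<close> I_sub cI ps(1) js AB_sub
      by (auto simp: increasing_in_def)
    define "is" ts where d: "is = sorted_list_of_set I" "ts = filter (\<lambda>t. t \<notin> set ps) js"
    have set_ts: "set ts = insert t Y" and set_is: "set is = I" and dts: "distinct ts"
      using js(1,2) ps(2,3) XY disj fin(1) by (auto simp: d sorted_wrt_less_iff)
    have tY: "t \<notin> Y" "I \<inter> X = {}" "I \<inter> Y = {}" "X \<inter> Y = {}" using XY ps(2) disj by blast+
    define F S where "F r = is @ take r ts @ drop (Suc r) ts" and "S r = is @ ts ! r # ps" for r
    have FS: "length (F r) = k \<and> length (S r) = k \<and> distinct (F r) \<and> distinct (S r)
        \<and> set (F r) \<subseteq> {1..n} \<and> set (S r) \<subseteq> {1..n}" if "r < length ts" for r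
      unfolding F_def S_def
      by (rule bracket_eq_sum(2)[OF rel _ d that,
          where Q = "\<lambda>\<alpha> \<beta>. length \<alpha> = k \<and> length \<beta> = k \<and> distinct \<alpha> \<and> distinct \<beta>
            \<and> set \<alpha> \<subseteq> {1..n} \<and> set \<beta> \<subseteq> {1..n}"]) auto
    have setF: "set (F r) = I \<union> (insert t Y - {ts ! r})" if "r < length ts" for r
    proof -
      have ts: "ts = take r ts @ ts ! r # drop (Suc r) ts" using that by (simp add: id_take_nth_drop)
      have "distinct (take r ts @ ts ! r # drop (Suc r) ts)" using dts ts by simp
      moreover have "set ts = insert (ts ! r) (set (take r ts) \<union> set (drop (Suc r) ts))"
        by (subst ts) simp
      ultimately have "set (take r ts) \<union> set (drop (Suc r) ts) = set ts - {ts ! r}" by auto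
      then show ?thesis using set_ts set_is by (simp add: F_def)
    qed
    have setS: "set (S r) = I \<union> insert (ts ! r) (X - {t})" for r
      by (simp add: S_def set_is ps(3))
    \<comment> \<open>The term that puts the dropped element \<open>t\<close> back: its two tuples
      have the entry sets \<open>I \<union> Y\<close> and \<open>I \<union> X\<close>, that is,
      those of \<alpha> and \<beta> in some order.\<close>
    obtain r0 where r0: "r0 < length ts" "ts ! r0 = t" using set_ts by (metis in_set_conv_nth insertI1)
    have agree: "alt_ext g \<gamma> = alt_ext h \<gamma>"
      if "length \<gamma> = k" "distinct \<gamma>" "set \<gamma> \<subseteq> {1..n}" "card (set \<gamma> - set \<alpha>) < s" for \<gamma>
    proof -
      have "g (sort \<gamma>) = h (sort \<gamma>)"
        using that less(1)[of "sort \<gamma>"] sort_in_index_tuples[of \<gamma> k n] by (simp add: s_def)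
      then show ?thesis by (simp add: alt_ext_def)
    qed
    have other: "alt_ext g (F r) * alt_ext g (S r) = alt_ext h (F r) * alt_ext h (S r)"
      if r: "r < length ts" "r \<noteq> r0" for r
    proof -
      have "ts ! r \<noteq> t" using r r0 dts by (simp add: nth_eq_iff_index_eq flip: r0(2))
      moreover have "ts ! r \<in> insert t Y" using r set_ts nth_mem by blast
      ultimately have u: "ts ! r \<in> Y" "ts ! r \<noteq> t" by blast+
      \<comment> \<open>One of the two tuples has exactly one entry outside \<alpha> and the other
        \<open>s - 1\<close>; both numbers are below \<open>s\<close> because
        \<open>s \<ge> 2\<close>.\<close>
      have "card (set (F r) - set \<alpha>) < s \<and> card (set (S r) - set \<alpha>) < s"
      using XY
      proof (elim disjE conjE)
        assume h: "X = A'" "Y = B'"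
        have "set (F r) - set \<alpha> = B' - {ts ! r}" "set (S r) - set \<alpha> = {ts ! r}"
          using u h disj ps(2) unfolding setF[OF r(1)] setS \<alpha>\<beta>(1) by blast+
        then show ?thesis using u h cB fin 3 by simp
      next
        assume h: "X = B'" "Y = A'"
        have "set (F r) - set \<alpha> = {t}" "set (S r) - set \<alpha> = B' - {t}"
          using u h disj ps(2) unfolding setF[OF r(1)] setS \<alpha>\<beta>(1) by blast+
        then show ?thesis using h cB fin 3 ps(2) by simp
      qed
      then show ?thesis using agree FS[OF r(1)] by simp
    qed
    have sum0: "(\<Sum>r<length ts. (-1) ^ r * alt_ext f (F r) * alt_ext f (S r)) = 0" if "f \<in> {g, h}" for f
      unfolding F_def S_def by (rule rels[OF that rel d])
    have split: "(\<Sum>r<length ts. T r) = T r0 + (\<Sum>r\<in>{..<length ts} - {r0}. T r)" for T :: "nat \<Rightarrow> real"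
      using r0(1) by (simp add: sum.remove)
    have "(\<Sum>r\<in>{..<length ts} - {r0}. (-1) ^ r * alt_ext g (F r) * alt_ext g (S r))
        = (\<Sum>r\<in>{..<length ts} - {r0}. (-1) ^ r * alt_ext h (F r) * alt_ext h (S r))"
      using other by (intro sum.cong refl) (simp add: mult.assoc)
    then have "(-1) ^ r0 * alt_ext g (F r0) * alt_ext g (S r0)
        = (-1) ^ r0 * alt_ext h (F r0) * alt_ext h (S r0)"
      using sum0[of g, OF insertI1] sum0[of h, OF insertI2, OF singletonI] unfolding split by linarith
    then have eq: "alt_ext g (F r0) * alt_ext g (S r0) = alt_ext h (F r0) * alt_ext h (S r0)"
      by (simp add: mult.assoc)
    have sorts: "sort (F r0) \<in> index_tuples n k" "sort (S r0) \<in> index_tuples n k"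
      using FS[OF r0(1)] sort_in_index_tuples by blast+
    have "set (sort (F r0)) = I \<union> Y" "set (sort (S r0)) = I \<union> X"
      using setF[OF r0(1)] setS[of r0] r0(2) tY ps(2) by auto
    then have "sort (F r0) = \<beta> \<and> sort (S r0) = \<alpha> \<or> sort (F r0) = \<alpha> \<and> sort (S r0) = \<beta>"
      using XY \<alpha>\<beta> index_tuples_eqI[OF sorts(1)] index_tuples_eqI[OF sorts(2)] \<alpha>(1) less(2) by metis
    \<comment> \<open>The signs do not depend on \<open>g\<close> or \<open>h\<close>, so, being
      nonzero, they cancel.\<close>
    moreover have "tuple_sign (F r0) \<noteq> 0" "tuple_sign (S r0) \<noteq> 0"
      using FS[OF r0(1)] tuple_sign_eq_0_iff by blast+
    ultimately show ?thesis using eq \<alpha>(2,3) by (auto simp: alt_ext_def)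
  qed
qed

section \<open>Surjectivity\<close>

context dual_basis
begin

lemma exists_vectors_with_minors:
  assumes k: "1 \<le> k"
    and \<alpha>: "\<alpha> \<in> index_tuples n k" "p \<alpha> = 1"
    and rels: "\<And>I js ps is ts. (I, js, ps) \<in> bracket_relations n k \<Longrightarrow>
        is = sorted_list_of_set I \<Longrightarrow> ts = filter (\<lambda>t. t \<notin> set ps) js \<Longrightarrow>
        (\<Sum>r<length ts. (-1) ^ r *
           alt_ext p (is @ take r ts @ drop (Suc r) ts) * alt_ext p (is @ ts ! r # ps)) = 0"
  shows "\<exists>xs. length xs = k \<and> (\<forall>\<beta>\<in>index_tuples n k. minor c \<beta> xs = p \<beta>)"
proof -
  note A = index_tuplesD[OF \<alpha>(1)]
  \<comment> \<open>This choice is forced: if the coordinates of \<open>xs\<close> at the indices of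
    \<alpha> form the identity matrix, then the \<open>j\<close>-th coordinate of
    \<open>xs ! i\<close> is the minor at \<open>\<alpha>[i := j]\<close>.\<close>
  define x where "x i = (\<Sum>j\<in>{1..n}. alt_ext p (\<alpha>[i := j]) *\<^sub>R e j)" for i
  define xs where "xs = map x [0..<k]"
  have xs: "length xs = k" by (simp add: xs_def)
  have c_x: "c j (xs ! i) = alt_ext p (\<alpha>[i := j])" if "i < k" "j \<in> {1..n}" for i j
  proof -
    have "c j (xs ! i) = (\<Sum>l\<in>{1..n}. alt_ext p (\<alpha>[i := l]) * c j (e l))"
      using that linear_c by (simp add: xs_def x_def linear_sum linear_scale)
    also have "\<dots> = (\<Sum>l\<in>{1..n}. if l = j then alt_ext p (\<alpha>[i := l]) else 0)"
      using that c_e by (intro sum.cong) auto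
    also have "\<dots> = alt_ext p (\<alpha>[i := j])" using that by simp
    finally show ?thesis .
  qed
  have in_n: "\<alpha> ! l \<in> {1..n}" if "l < k" for l using that A(1,2) nth_mem by blast
  \<comment> \<open>For \<open>l \<noteq> i\<close> the tuple
    \<open>\<alpha>[i := \<alpha> ! l]\<close> repeats an entry and \<open>alt_ext\<close> gives 0;
    for \<open>l = i\<close> it is \<alpha> itself, where \<open>p\<close> is 1.\<close>
  have unit: "c (\<alpha> ! l) (xs ! i) = of_bool (l = i)" if "l < k" "i < k" for l i
  proof (cases "l = i")
    case True
    then show ?thesis using c_x[OF that(2) in_n[OF that(1)]] alt_ext_increasing[OF \<alpha>(1)] \<alpha>(2) by simp
  next
    case False
    then have "\<alpha>[i := \<alpha> ! l] ! i = \<alpha>[i := \<alpha> ! l] ! l" using that A(1) by simp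
    then have "\<not> distinct (\<alpha>[i := \<alpha> ! l])"
      using that A(1) False by (metis length_list_update nth_eq_iff_index_eq)
    then show ?thesis using c_x[OF that(2) in_n[OF that(1)]] tuple_sign_eq_0_iff False
      by (simp add: alt_ext_def)
  qed
  have minor_upd: "minor c (\<alpha>[i := j]) xs = alt_ext p (\<alpha>[i := j])" if "i < k" "j \<in> {1..n}" for i j
  proof -
    have "minor c (\<alpha>[i := j]) xs = c (\<alpha>[i := j] ! i) (xs ! i)"
      by (rule minor_unit_rows) (use that A(1) unit in auto)
    then show ?thesis using that A(1) c_x by simp
  qed
  have m\<alpha>: "minor c \<alpha> xs = 1"
    using minor_upd[of 0 "\<alpha> ! 0"] k in_n[of 0] alt_ext_increasing[OF \<alpha>(1)] \<alpha>(2) by simp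
  have "minor c \<beta> xs = p \<beta>" if "\<beta> \<in> index_tuples n k" for \<beta>
  proof (rule determined_by_neighbours[where g = "\<lambda>\<beta>. minor c \<beta> xs" and h = p and \<alpha> = \<alpha> and k = k and n = n])
    fix f I js ps "is" ts
    assume f: "f \<in> {\<lambda>\<beta>. minor c \<beta> xs, p}" and rel: "(I, js, ps) \<in> bracket_relations n k"
      and d: "is = sorted_list_of_set I" "ts = filter (\<lambda>t. t \<notin> set ps) js"
    from rel obtain s where s: "2 \<le> s" "length is + s = k" "length ts = Suc s" "Suc (length ps) = s"
      by (rule bracket_relationsD) (use d in blast)
    have "alt_ext (\<lambda>\<beta>. minor c \<beta> xs) (is @ take r ts @ drop (Suc r) ts) = minor c (is @ take r ts @ drop (Suc r) ts) xs"
      "alt_ext (\<lambda>\<beta>. minor c \<beta> xs) (is @ ts ! r # ps) = minor c (is @ ts ! r # ps) xs"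
      if "r < length ts" for r
      using s xs that by (simp_all add: alt_ext_minor)
    then have "(\<Sum>r<length ts. (-1) ^ r * alt_ext (\<lambda>\<beta>. minor c \<beta> xs) (is @ take r ts @ drop (Suc r) ts)
          * alt_ext (\<lambda>\<beta>. minor c \<beta> xs) (is @ ts ! r # ps)) = 0"
      using minor_bracket[OF rel xs d, of c] by simp
    then show "(\<Sum>r<length ts. (-1) ^ r * alt_ext f (is @ take r ts @ drop (Suc r) ts)
          * alt_ext f (is @ ts ! r # ps)) = 0"
      using f rels[OF rel d] by auto
  next
    fix \<beta> assume \<beta>: "\<beta> \<in> index_tuples n k" "card (set \<beta> - set \<alpha>) = 1"
    note B = index_tuplesD[OF \<beta>(1)]
    obtain j where j: "set \<beta> - set \<alpha> = {j}" using \<beta>(2) by (rule card_1_singletonE)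
    have "card (set \<alpha> - set \<beta>) = 1"
    proof -
      have "card (set \<alpha> - set \<beta>) + card (set \<alpha> \<inter> set \<beta>) = card (set \<beta> - set \<alpha>) + card (set \<beta> \<inter> set \<alpha>)"
        using A(7) B(7) card_Int_Diff[of "set \<alpha>" "set \<beta>"] card_Int_Diff[of "set \<beta>" "set \<alpha>"] by simp
      then show ?thesis using \<beta>(2) by (simp add: Int_commute)
    qed
    then obtain l where l: "set \<alpha> - set \<beta> = {l}" by (rule card_1_singletonE)
    then obtain i where i: "i < k" "\<alpha> ! i = l" using A(1) by (metis DiffD1 in_set_conv_nth insertI1)
    \<comment> \<open>A neighbour \<beta> of \<alpha> is, up to sorting, \<alpha> with the entry
      \<open>l\<close> at position \<open>i\<close> replaced by \<open>j\<close>; the sign of the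
      sorting occurs on both sides and cancels.\<close>
    let ?\<gamma> = "\<alpha>[i := j]"
    have jn: "j \<in> {1..n}" "j \<notin> set \<alpha>" using j B(2) by blast+
    have "set ?\<gamma> = insert j (set \<alpha> - {l})"
      using set_update_distinct[OF A(3), of i j] i A(1) by simp
    then have set: "set ?\<gamma> = set \<beta>" using j l by blast
    have dist: "distinct ?\<gamma>" using A(3) jn(2) by (simp add: distinct_list_update)
    have sort: "sort ?\<gamma> = \<beta>"
      using sort_in_index_tuples[of ?\<gamma> k n] A(1) set B(2) dist
      by (intro index_tuples_eqI[OF _ \<beta>(1)]) auto
    have "tuple_sign ?\<gamma> * minor c \<beta> xs = tuple_sign ?\<gamma> * p \<beta>"
      using minor_upd[OF i(1) jn(1)] minor_index[of xs ?\<gamma> c] A(1) xs by (simp add: alt_ext_def sort)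
    then show "minor c \<beta> xs = p \<beta>" using dist tuple_sign_eq_0_iff[of ?\<gamma>] by simp
  qed (use \<alpha> m\<alpha> that in auto)
  then show ?thesis using xs by blast
qed

text \<open>The relations are homogeneous, so the square is recovered only up to a factor.
  \<open>K\<close> may be negative and then cannot be absorbed into \<open>xs\<close>, but it does
  not change the projective point.\<close>

lemma relations_imp_square:
  assumes k: "1 \<le> k" and rel: "satisfies_relations n k q"
    and nz: "vector_of_coords e n k q \<noteq> 0"
  shows "\<exists>K xs. K \<noteq> 0 \<and> length xs = k \<and>
           vector_of_coords e n k q = K *\<^sub>R vee (wedge xs) (wedge xs)"
proof -
  let ?P = "index_tuples n k"
  define Q where "Q \<alpha> \<beta> = (if tuple_ge \<alpha> \<beta> then q (\<alpha>, \<beta>) else q (\<beta>, \<alpha>))" for \<alpha> \<beta>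
  have qc: "qc q \<alpha> \<beta> = Q \<alpha> \<beta>" if "\<alpha> \<in> ?P" "\<beta> \<in> ?P" for \<alpha> \<beta>
    using that by (simp add: qc_def Q_def index_tuplesD)
  have Q_sym: "Q \<alpha> \<beta> = Q \<beta> \<alpha>" if "\<alpha> \<in> ?P" "\<beta> \<in> ?P" for \<alpha> \<beta>
    using that tuple_ge_total[of \<alpha> \<beta>] tuple_ge_antisym[of \<alpha> \<beta>]
    by (auto simp: Q_def index_tuplesD(1))
  have sq: "(Q \<alpha> \<beta>)\<^sup>2 = 4 * Q \<alpha> \<alpha> * Q \<beta> \<beta>" if "\<alpha> \<in> ?P" "\<beta> \<in> ?P" "\<alpha> \<noteq> \<beta>" for \<alpha> \<beta>
    using rel that unfolding satisfies_relations_def square_relation_def by (simp add: qc)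
  have mixed: "Q \<alpha> \<beta> * Q \<alpha> \<gamma> = 2 * Q \<alpha> \<alpha> * Q \<beta> \<gamma>"
    if "\<alpha> \<in> ?P" "\<beta> \<in> ?P" "\<gamma> \<in> ?P" "\<alpha> \<noteq> \<beta>" "\<alpha> \<noteq> \<gamma>" "\<beta> \<noteq> \<gamma>" for \<alpha> \<beta> \<gamma>
    using rel that unfolding satisfies_relations_def mixed_relation_def by (simp add: qc)
  \<comment> \<open>If all diagonal coordinates vanished, (ii) would make every coordinate
    vanish.\<close>
  have "\<exists>\<alpha>\<in>?P. Q \<alpha> \<alpha> \<noteq> 0"
  proof (rule ccontr)
    assume "\<not> ?thesis"
    then have "Q \<alpha> \<beta> = 0" if "\<alpha> \<in> ?P" "\<beta> \<in> ?P" for \<alpha> \<beta>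
      using that sq[of \<alpha> \<beta>] by (cases "\<alpha> = \<beta>") auto
    then have "q (\<alpha>, \<beta>) = 0" if "(\<alpha>, \<beta>) \<in> coord_indices n k" for \<alpha> \<beta>
      using that by (force simp: coord_indices_def Q_def)
    then have "vector_of_coords e n k q = 0"
      unfolding vector_of_coords_def by (intro sum.neutral) auto
    with nz show False by simp
  qed
  then obtain \<alpha> where \<alpha>: "\<alpha> \<in> ?P" and K: "Q \<alpha> \<alpha> \<noteq> 0" by blast
  define K where "K = Q \<alpha> \<alpha>"
  \<comment> \<open>Solves \<open>Q \<alpha> \<beta> = 2 * K * p \<alpha> * p \<beta>\<close> for
    \<open>p \<beta>\<close> under the normalization \<open>p \<alpha> = 1\<close>.\<close>
  define p where "p \<beta> = (if \<beta> = \<alpha> then 1 else Q \<alpha> \<beta> / (2 * K))" for \<beta>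
  have K0: "K \<noteq> 0" using K by (simp add: K_def)
  \<comment> \<open>In the row and column of \<alpha> this is the choice of \<open>K\<close> and
    \<open>p\<close>. Elsewhere (ii) for \<alpha> and \<gamma> gives the diagonal value at \<gamma>,
    and (iii) with \<alpha> as the repeated tuple gives the off-diagonal ones.\<close>
  have Qp: "Q \<beta> \<gamma> = (if \<beta> = \<gamma> then K else 2 * K) * p \<beta> * p \<gamma>" if "\<beta> \<in> ?P" "\<gamma> \<in> ?P" for \<beta> \<gamma>
  proof -
    consider "\<beta> = \<alpha>" "\<gamma> = \<alpha>" | "\<beta> = \<gamma>" "\<gamma> \<noteq> \<alpha>" | "\<beta> = \<alpha>" "\<gamma> \<noteq> \<alpha>" | "\<beta> \<noteq> \<alpha>" "\<gamma> = \<alpha>"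
      | "\<beta> \<noteq> \<alpha>" "\<gamma> \<noteq> \<alpha>" "\<beta> \<noteq> \<gamma>" by blast
    then show ?thesis
    proof cases
      case 1
      then show ?thesis by (simp add: p_def K_def)
    next
      case 2
      then show ?thesis
        using sq[OF \<alpha> that(2)] K0 by (simp add: p_def K_def[symmetric] field_simps power2_eq_square)
    next
      case 3
      then show ?thesis using K0 by (simp add: p_def)
    next
      case 4
      then show ?thesis using K0 Q_sym[OF that] by (simp add: p_def)
    next
      case 5
      then show ?thesis
        using mixed[OF \<alpha> that] K0 by (simp add: p_def K_def[symmetric] field_simps)
    qed
  qed
  have "(\<Sum>r<length ts. (-1) ^ r *
           alt_ext p (is @ take r ts @ drop (Suc r) ts) * alt_ext p (is @ ts ! r # ps)) = 0"
    if r: "(I, js, ps) \<in> bracket_relations n k"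
      and d: "is = sorted_list_of_set I" "ts = filter (\<lambda>t. t \<notin> set ps) js" for I js ps "is" ts
  proof -
    have "bracket q I js ps = - (2 * K) * (\<Sum>r<length ts. (-1) ^ r *
           alt_ext p (is @ take r ts @ drop (Suc r) ts) * alt_ext p (is @ ts ! r # ps))"
      by (rule bracket_alt_ext[OF r _ d]) (use Qp in \<open>simp add: Q_def\<close>)
    moreover have "bracket q I js ps = 0"
      using bspec[OF conjunct1[OF rel[unfolded satisfies_relations_def]] r] by simp
    ultimately show ?thesis using K0 by simp
  qed
  note bracket_p = this
  have "p \<alpha> = 1" by (simp add: p_def)
  have "\<exists>xs. length xs = k \<and> (\<forall>\<beta>\<in>?P. minor c \<beta> xs = p \<beta>)"
    by (rule exists_vectors_with_minors[where p = p, OF k \<alpha> \<open>p \<alpha> = 1\<close>], rule bracket_p)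
  then obtain xs where xs: "length xs = k" "\<And>\<beta>. \<beta> \<in> ?P \<Longrightarrow> minor c \<beta> xs = p \<beta>" by blast
  have "wedge xs = (\<Sum>\<beta>\<in>?P. p \<beta> *\<^sub>R e_tuple e \<beta>)"
    unfolding wedge_expansion[OF xs(1)] using xs(2) by (intro sum.cong) auto
  then have "vee (wedge xs) (wedge xs) = vector_of_coords e n k (square_coords p)"
    by (rule vee_square_coords)
  moreover have "vector_of_coords e n k q = K *\<^sub>R vector_of_coords e n k (square_coords p)"
  proof -
    have "q (\<beta>, \<gamma>) = K * square_coords p (\<beta>, \<gamma>)" if "(\<beta>, \<gamma>) \<in> coord_indices n k" for \<beta> \<gamma>
      using that Qp[of \<beta> \<gamma>] by (auto simp: coord_indices_def Q_def square_coords_def)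
    then show ?thesis
      unfolding vector_of_coords_def scaleR_sum_right by (intro sum.cong) auto
  qed
  ultimately have "vector_of_coords e n k q = K *\<^sub>R vee (wedge xs) (wedge xs)" by simp
  then show ?thesis using K0 xs(1) by blast
qed

end

section \<open>Linearity and ranks\<close>

lemma is_linear_form_coord: "finite P \<Longrightarrow> i \<in> P \<Longrightarrow> is_linear_form P (\<lambda>q. q i)"
  unfolding is_linear_form_def by (rule exI[of _ "\<lambda>j. of_bool (j = i)"]) simp

lemma is_linear_form_scale: "is_linear_form P F \<Longrightarrow> is_linear_form P (\<lambda>q. a * F q)"
  unfolding is_linear_form_def
proof (elim exE)
  fix c assume "\<forall>q. F q = (\<Sum>i\<in>P. c i * q i)"
  then show "\<exists>c. \<forall>q. a * F q = (\<Sum>i\<in>P. c i * q i)"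
    by (intro exI[of _ "\<lambda>i. a * c i"]) (simp add: sum_distrib_left mult.assoc)
qed

lemma is_linear_form_sum:
  assumes "\<And>r. r \<in> S \<Longrightarrow> is_linear_form P (F r)"
  shows "is_linear_form P (\<lambda>q. \<Sum>r\<in>S. F r q)"
proof -
  have "\<forall>r\<in>S. \<exists>c. \<forall>q. F r q = (\<Sum>i\<in>P. c i * q i)"
    using assms by (simp add: is_linear_form_def)
  from bchoice[OF this] obtain c where c: "\<forall>r\<in>S. \<forall>q. F r q = (\<Sum>i\<in>P. c r i * q i)" by blast
  have "(\<Sum>r\<in>S. F r q) = (\<Sum>i\<in>P. (\<Sum>r\<in>S. c r i) * q i)" for q
  proof -
    have "(\<Sum>r\<in>S. F r q) = (\<Sum>r\<in>S. \<Sum>i\<in>P. c r i * q i)" using c by simp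
    also have "\<dots> = (\<Sum>i\<in>P. (\<Sum>r\<in>S. c r i) * q i)"
      by (subst sum.swap) (simp add: sum_distrib_right)
    finally show ?thesis .
  qed
  then show ?thesis
    unfolding is_linear_form_def by (intro exI[of _ "\<lambda>i. \<Sum>r\<in>S. c r i"] allI)
qed

lemma finite_coord_indices [simp]: "finite (coord_indices n k)"
  by (rule finite_subset[of _ "index_tuples n k \<times> index_tuples n k"]) (auto simp: coord_indices_def)

definition coord_index :: "nat list \<Rightarrow> nat list \<Rightarrow> nat list \<times> nat list" where
  "coord_index \<alpha> \<beta> = (if tuple_ge \<alpha> \<beta> then (\<alpha>, \<beta>) else (\<beta>, \<alpha>))"

lemma coord_index_in:
  "\<alpha> \<in> index_tuples n k \<Longrightarrow> \<beta> \<in> index_tuples n k \<Longrightarrow> coord_index \<alpha> \<beta> \<in> coord_indices n k"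
  using tuple_ge_total[of \<alpha> \<beta>] by (auto simp: coord_index_def coord_indices_def index_tuplesD(1))

lemma coord_index_eq_iff: "coord_index \<alpha> \<beta> = coord_index \<gamma> \<delta> \<Longrightarrow> {\<alpha>, \<beta>} = {\<gamma>, \<delta>}"
  by (auto simp: coord_index_def split: if_splits)

lemma qc_coord_index: "qc q \<alpha> \<beta> = tuple_sign \<alpha> * tuple_sign \<beta> * q (coord_index (sort \<alpha>) (sort \<beta>))"
  by (simp add: qc_def coord_index_def)

lemma qc_increasing:
  "\<alpha> \<in> index_tuples n k \<Longrightarrow> \<beta> \<in> index_tuples n k \<Longrightarrow> qc q \<alpha> \<beta> = q (coord_index \<alpha> \<beta>)"
  by (simp add: qc_coord_index index_tuplesD)

text \<open>Each \<open>qc\<close> in the bracket is a fixed sign times a single coordinate, since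
  its tuples have distinct entries in \<open>{1..n}\<close> and sort to index tuples.\<close>

lemma bracket_linear:
  assumes rel: "(I, js, ps) \<in> bracket_relations n k"
  shows "is_linear_form (coord_indices n k) (\<lambda>q. bracket q I js ps)"
proof -
  define "is" ts where d: "is = sorted_list_of_set I" "ts = filter (\<lambda>t. t \<notin> set ps) js"
  let ?Q = "\<lambda>\<alpha> \<beta>. is_linear_form (coord_indices n k) (\<lambda>q. qc q \<alpha> \<beta>)"
  have Q: "?Q \<alpha> \<beta>" if "length \<alpha> = k" "length \<beta> = k" "set \<alpha> \<subseteq> {1..n}" "set \<beta> \<subseteq> {1..n}"
      "distinct \<alpha>" "distinct \<beta>" for \<alpha> \<beta>
    unfolding qc_coord_index
    using that by (intro is_linear_form_scale is_linear_form_coord coord_index_in sort_in_index_tuples) auto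
  note lin = bracket_eq_sum(2)[OF rel _ d, where Q = ?Q]
  have "is_linear_form (coord_indices n k) (\<lambda>q. \<Sum>r<length ts. (-1) ^ Suc r *
           qc q (is @ take r ts @ drop (Suc r) ts) (is @ ts ! r # ps))"
  proof (intro is_linear_form_sum is_linear_form_scale)
    fix r assume "r \<in> {..<length ts}"
    then show "?Q (is @ take r ts @ drop (Suc r) ts) (is @ ts ! r # ps)"
      by (intro lin Q) auto
  qed
  then show ?thesis
    using bracket_eq_sum(1)[OF rel TrueI d] by simp
qed

text \<open>The matrix is monomial on \<open>T\<close>: row \<open>i\<close> has the single entry
  \<open>w i\<close>, in column \<open>\<pi> i\<close>, and rows outside \<open>T\<close> vanish.
  The rows of \<open>T\<close> are thus nonzero multiples of different unit vectors. Both (ii) and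
  (iii) have this shape.\<close>

lemma rank_matching:
  fixes w :: "'i \<Rightarrow> real"
  assumes "finite P" "T \<subseteq> P"
    and \<pi>: "\<And>i. i \<in> T \<Longrightarrow> \<pi> i \<in> T" "\<And>i. i \<in> T \<Longrightarrow> \<pi> (\<pi> i) = i"
    and w: "\<And>i. i \<in> T \<Longrightarrow> w i \<noteq> 0" "\<And>i. i \<in> T \<Longrightarrow> w (\<pi> i) = w i"
  shows "is_quadratic_form_of_rank P (\<lambda>q. \<Sum>i\<in>T. w i * q i * q (\<pi> i)) (card T)"
proof -
  define A where "A i j = (if i \<in> T \<and> j = \<pi> i then w i else 0)" for i j
  have sym: "A i j = A j i" for i j
    using \<pi> w by (auto simp: A_def)
  have eq: "(\<Sum>i\<in>T. w i * q i * q (\<pi> i)) = (\<Sum>i\<in>P. \<Sum>j\<in>P. A i j * q i * q j)" for q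
  proof -
    have "(\<Sum>j\<in>P. A i j * q i * q j) = (if i \<in> T then w i * q i * q (\<pi> i) else 0)" for i
    proof (cases "i \<in> T")
      case True
      then have "(\<Sum>j\<in>P. A i j * q i * q j) = (\<Sum>j\<in>P. if j = \<pi> i then w i * q i * q j else 0)"
        by (intro sum.cong) (auto simp: A_def)
      then show ?thesis using True \<pi>(1) assms(1,2) by auto
    qed (simp add: A_def)
    then show ?thesis
      using assms(1,2) by (simp add: sum.If_cases Int_absorb1)
  qed
  define R where "R i = (\<lambda>j. if j \<in> P then A i j else 0)" for i
  have R_T: "R i = (\<lambda>j. if j = \<pi> i then w i else 0)" if "i \<in> T" for i
  proof -
    have "\<pi> i \<in> P" using that \<pi>(1) assms(2) by blast
    then show ?thesis using that by (auto simp: R_def A_def intro!: ext)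
  qed
  have R_0: "R i = 0" if "i \<notin> T" for i
    using that by (auto simp: R_def A_def zero_fun_def)
  have R_\<pi>: "R i (\<pi> i) = w i" if "i \<in> T" for i using that R_T by simp
  have R_other: "R i (\<pi> j) = 0" if "i \<in> T" "j \<in> T" "i \<noteq> j" for i j
  proof -
    have "\<pi> j \<noteq> \<pi> i" using \<pi>(2)[OF that(1)] \<pi>(2)[OF that(2)] that(3) by metis
    then show ?thesis by (simp add: R_T[OF that(1)])
  qed
  have inj: "inj_on R T"
  proof (rule inj_onI, rule ccontr)
    fix i j assume ij: "i \<in> T" "j \<in> T" "R i = R j" "i \<noteq> j"
    then show False using R_\<pi>[of j] R_other[of i j] w(1)[of j] by simp
  qed
  have ind: "independent (R ` T)"
    unfolding dependent_def
  proof (safe)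
    fix i assume i: "i \<in> T" "R i \<in> span (R ` T - {R i})"
    \<comment> \<open>Evaluation at \<open>\<pi> i\<close> separates \<open>R i\<close> from the
      other rows: they all vanish there, while \<open>R i\<close> takes the value
      \<open>w i\<close>.\<close>
    have "subspace {f :: 'i \<Rightarrow> real. f (\<pi> i) = 0}"
      by (auto simp: subspace_def zero_fun_def plus_fun_def scaleR_fun_def)
    moreover have "R ` T - {R i} \<subseteq> {f. f (\<pi> i) = 0}" using R_other[OF _ i(1)] by auto
    ultimately have "R i (\<pi> i) = 0" using i(2) span_minimal by blast
    then show False using R_\<pi>[OF i(1)] w(1)[OF i(1)] by simp
  qed
  have "R ` P \<subseteq> span (R ` T)"
  proof
    fix f assume "f \<in> R ` P"
    then obtain i where "f = R i" by blast
    then show "f \<in> span (R ` T)" using R_0[of i] by (cases "i \<in> T") (auto intro: span_base span_zero)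
  qed
  then have "dim (R ` P) = card T"
    using ind assms(2) card_image[OF inj] by (intro dim_unique[of "R ` T"]) auto
  moreover have "rank_on P A = dim (R ` P)"
    unfolding rank_on_def R_def ..
  ultimately have "rank_on P A = card T" by simp
  moreover have "is_symmetric_matrix_of P A (\<lambda>q. \<Sum>i\<in>T. w i * q i * q (\<pi> i))"
    unfolding is_symmetric_matrix_of_def using sym eq by blast
  ultimately show ?thesis unfolding is_quadratic_form_of_rank_def by blast
qed

lemma square_relation_rank:
  assumes "\<alpha> \<in> index_tuples n k" "\<beta> \<in> index_tuples n k" "\<alpha> \<noteq> \<beta>"
  shows "is_quadratic_form_of_rank (coord_indices n k) (square_relation \<alpha> \<beta>) 3"
proof -
  define a b d where abd: "a = coord_index \<alpha> \<beta>" "b = coord_index \<alpha> \<alpha>" "d = coord_index \<beta> \<beta>"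
  have ne: "a \<noteq> b" "a \<noteq> d" "b \<noteq> d"
    using coord_index_eq_iff[of \<alpha> \<beta> \<alpha> \<alpha>] coord_index_eq_iff[of \<alpha> \<beta> \<beta> \<beta>]
      coord_index_eq_iff[of \<alpha> \<alpha> \<beta> \<beta>] assms(3)
    unfolding abd by auto
  let ?T = "{a, b, d}"
  \<comment> \<open>The square of \<open>q a\<close> gives a fixed point of the involution; the
    coefficient -4 of \<open>q b * q d\<close> is split evenly over the two symmetric
    entries.\<close>
  let ?\<pi> = "\<lambda>i. if i = b then d else if i = d then b else i"
  let ?w = "\<lambda>i. if i = a then 1 else - 2 :: real"
  have "is_quadratic_form_of_rank (coord_indices n k) (\<lambda>q. \<Sum>i\<in>?T. ?w i * q i * q (?\<pi> i)) (card ?T)"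
  proof (rule rank_matching)
    show "?T \<subseteq> coord_indices n k" using assms coord_index_in by (auto simp: abd)
  qed (use ne in auto)
  moreover have "card ?T = 3" using ne by simp
  moreover have "(\<lambda>q. \<Sum>i\<in>?T. ?w i * q i * q (?\<pi> i)) = square_relation \<alpha> \<beta>"
  proof
    fix q :: "nat list \<times> nat list \<Rightarrow> real"
    have "(\<Sum>i\<in>?T. ?w i * q i * q (?\<pi> i)) = q a * q a - 4 * q b * q d"
      using ne by simp
    then show "(\<Sum>i\<in>?T. ?w i * q i * q (?\<pi> i)) = square_relation \<alpha> \<beta> q"
      by (simp add: square_relation_def qc_increasing[OF assms(1,2)] qc_increasing[OF assms(1,1)]
          qc_increasing[OF assms(2,2)] abd power2_eq_square)
  qed
  ultimately show ?thesis by (simp only:)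
qed

lemma mixed_relation_rank:
  assumes "\<alpha> \<in> index_tuples n k" "\<beta> \<in> index_tuples n k" "\<gamma> \<in> index_tuples n k"
    "\<alpha> \<noteq> \<beta>" "\<alpha> \<noteq> \<gamma>" "\<beta> \<noteq> \<gamma>"
  shows "is_quadratic_form_of_rank (coord_indices n k) (mixed_relation \<alpha> \<beta> \<gamma>) 4"
proof -
  define a b d f where abdf: "a = coord_index \<alpha> \<beta>" "b = coord_index \<alpha> \<gamma>" "d = coord_index \<alpha> \<alpha>"
    "f = coord_index \<beta> \<gamma>"
  have ne: "a \<noteq> b" "a \<noteq> d" "a \<noteq> f" "b \<noteq> d" "b \<noteq> f" "d \<noteq> f"
    using coord_index_eq_iff[of \<alpha> \<beta> \<alpha> \<gamma>] coord_index_eq_iff[of \<alpha> \<beta> \<alpha> \<alpha>]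
      coord_index_eq_iff[of \<alpha> \<beta> \<beta> \<gamma>] coord_index_eq_iff[of \<alpha> \<gamma> \<alpha> \<alpha>]
      coord_index_eq_iff[of \<alpha> \<gamma> \<beta> \<gamma>] coord_index_eq_iff[of \<alpha> \<alpha> \<beta> \<gamma>] assms(4-6)
    unfolding abdf by (auto simp: doubleton_eq_iff)
  let ?T = "{a, b, d, f}"
  \<comment> \<open>Two transpositions, one for each product; the coefficients 1 and -2 are halved
    because each product arises twice. The last \<open>else\<close> is the case
    \<open>i = f\<close>.\<close>
  let ?\<pi> = "\<lambda>i. if i = a then b else if i = b then a else if i = d then f else d"
  let ?w = "\<lambda>i. if i = a \<or> i = b then 1 / 2 else - 1 :: real"
  have "is_quadratic_form_of_rank (coord_indices n k) (\<lambda>q. \<Sum>i\<in>?T. ?w i * q i * q (?\<pi> i)) (card ?T)"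
  proof (rule rank_matching)
    show "?T \<subseteq> coord_indices n k" using assms coord_index_in by (auto simp: abdf)
  qed (use ne in auto)
  moreover have "card ?T = 4" using ne by simp
  moreover have "(\<lambda>q. \<Sum>i\<in>?T. ?w i * q i * q (?\<pi> i)) = mixed_relation \<alpha> \<beta> \<gamma>"
  proof
    fix q :: "nat list \<times> nat list \<Rightarrow> real"
    have "(\<Sum>i\<in>?T. ?w i * q i * q (?\<pi> i)) = q a * q b - 2 * q d * q f"
      using ne by simp
    then show "(\<Sum>i\<in>?T. ?w i * q i * q (?\<pi> i)) = mixed_relation \<alpha> \<beta> \<gamma> q"
      by (simp add: mixed_relation_def qc_increasing[OF assms(1,2)] qc_increasing[OF assms(1,3)]
          qc_increasing[OF assms(1,1)] qc_increasing[OF assms(2,3)] abdf)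
  qed
  ultimately show ?thesis by (simp only:)
qed

section \<open>The Grassmannian\<close>

lemma alternating_scale: "f \<in> alternating_forms k \<Longrightarrow> (\<lambda>xs. a * f xs) \<in> alternating_forms k"
  using alternating_sum[of "{()}" "\<lambda>_. f" k "\<lambda>_. a"] by simp

text \<open>A vector in the span of the others can be replaced, by linearity in its slot, with these
  others; each replacement repeats an entry and gives 0.\<close>

lemma alternating_nonzero_independent:
  assumes f: "f \<in> alternating_forms (length xs)" and nz: "f xs \<noteq> 0"
  shows "distinct xs \<and> independent (set xs)"
proof
  show dist: "distinct xs" using alternating_not_distinct[OF f refl] nz by blast
  show "independent (set xs)"
  proof
    assume "dependent (set xs)"
    then obtain x where x: "x \<in> set xs" "x \<in> span (set xs - {x})" unfolding dependent_def by blast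
    then obtain ys zs where xs: "xs = ys @ x # zs" by (meson split_list)
    have lin: "linear (\<lambda>v. f (ys @ v # zs))" by (rule alternating_linear[OF f]) (simp add: xs)
    have "set xs - {x} = set (ys @ zs)" using dist xs by auto
    moreover have "f (ys @ v # zs) = 0" if "v \<in> set (ys @ zs)" for v
      using that by (intro alternating_not_distinct[OF f]) (auto simp: xs)
    ultimately have "f (ys @ x # zs) = 0" using linear_eq_0_on_span[OF lin] x(2) by metis
    then show False using nz xs by simp
  qed
qed

lemma wedge_nonzero_iff: "wedge xs \<noteq> 0 \<longleftrightarrow> distinct xs \<and> independent (set xs)"
proof
  assume "wedge xs \<noteq> 0"
  then obtain f where "wedge xs f \<noteq> 0" by (auto simp: zero_fun_def)
  then show "distinct xs \<and> independent (set xs)"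
    using alternating_nonzero_independent[of f xs] by (simp add: wedge_def split: if_splits)
next
  assume "distinct xs \<and> independent (set xs)"
  then obtain f where "f \<in> alternating_forms (length xs)" "f xs \<noteq> 0"
    using alternating_form_nonzero by blast
  then have "wedge xs f \<noteq> 0" by (simp add: wedge_def)
  then show "wedge xs \<noteq> 0" by (auto simp: zero_fun_def)
qed

lemma index_tuples_full:
  assumes "\<alpha> \<in> index_tuples k k"
  shows "\<alpha> = [1..<Suc k]"
proof -
  have "set \<alpha> = {1..k}"
    using index_tuplesD(2,7)[OF assms] by (intro card_subset_eq) auto
  then show ?thesis
    using assms by (intro increasing_unique) (auto simp: index_tuples_def simp del: upt_Suc)
qed

text \<open>On the span of \<open>ys\<close> the forms of degree \<open>length ys\<close> are
  determined by their value at \<open>ys\<close>, the only increasing tuple there. The combination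
  of \<open>f\<close> and \<open>g\<close> that vanishes at \<open>ys\<close> hence vanishes on
  \<open>xs\<close>.\<close>

lemma alternating_forms_proportional:
  assumes "f \<in> alternating_forms (length ys)" "g \<in> alternating_forms (length ys)"
    and xs: "length xs = length ys" "set xs \<subseteq> span (set ys)"
  shows "f xs * g ys = g xs * f ys"
proof -
  let ?k = "length ys"
  \<comment> \<open>Index tuples start at 1, list positions at 0.\<close>
  define y where "y i = ys ! (i - 1)" for i
  have map: "map y [1..<Suc ?k] = ys"
    by (rule nth_equalityI) (auto simp: y_def simp del: upt_Suc)
  have "y ` {1..?k} = set (map y [1..<Suc ?k])"
    unfolding set_map set_upt by (simp only: atLeastLessThanSuc_atLeastAtMost)
  then have set: "y ` {1..?k} = set ys" by (simp only: map)
  let ?h = "\<lambda>zs. g ys * f zs - f ys * g zs"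
  have "?h xs = 0"
  proof (rule alternating_eq_0[where f = ?h and k = ?k and m = ?k and y = y])
    show "?h \<in> alternating_forms ?k"
      by (intro alternating_diff alternating_scale assms)
    show "?h (map y \<alpha>) = 0" if "\<alpha> \<in> index_tuples ?k ?k" for \<alpha>
      unfolding index_tuples_full[OF that] map by simp
  qed (use xs set in auto)
  then show ?thesis by (simp add: mult.commute)
qed

text \<open>The factor is the determinant expressing \<open>xs\<close> in the basis
  \<open>ys\<close>, computed as \<open>g xs / g ys\<close> from one form \<open>g\<close> that does
  not vanish at \<open>ys\<close>.\<close>

lemma wedge_proportional:
  assumes "length xs = length ys" "set xs \<subseteq> span (set ys)"
    and "distinct ys" "independent (set ys)"
  shows "\<exists>a. wedge xs = a *\<^sub>R wedge ys"
proof -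
  obtain g where g: "g \<in> alternating_forms (length ys)" "g ys \<noteq> 0"
    using alternating_form_nonzero[OF assms(3,4)] by blast
  have "wedge xs f = (g xs / g ys) * wedge ys f" for f
    using alternating_forms_proportional[OF _ g(1) assms(1,2), of f] assms(1) g(2)
    by (simp add: wedge_def field_simps)
  then have "wedge xs = (g xs / g ys) *\<^sub>R wedge ys" by (auto simp: scaleR_fun_def)
  then show ?thesis by blast
qed

section \<open>Squares as projective points\<close>

lemma vee_square_scale: "vee (a *\<^sub>R w) (a *\<^sub>R w) = a\<^sup>2 *\<^sub>R vee w w"
  by (rule ext) (auto simp: vee_def scaleR_fun_def bilinear_lmul bilinear_rmul power2_eq_square)

text \<open>Test the equation on the symmetric bilinear form that multiplies the values of its two
  arguments at \<open>f\<close>.\<close>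

lemma vee_square_values:
  fixes w w' :: "'a \<Rightarrow> real"
  assumes "vee w w = K *\<^sub>R vee w' w'"
  shows "(w f)\<^sup>2 = K * (w' f)\<^sup>2"
proof -
  define B :: "('a \<Rightarrow> real) \<Rightarrow> ('a \<Rightarrow> real) \<Rightarrow> real" where "B = (\<lambda>u v. u f * v f)"
  have "bilinear B"
    unfolding bilinear_def B_def
    by (auto intro!: linearI simp: plus_fun_def scaleR_fun_def algebra_simps)
  moreover have "\<forall>x y. B x y = B y x" by (simp add: B_def mult.commute)
  ultimately have "vee u v B = u f * v f" for u v by (simp add: vee_def B_def)
  then show ?thesis using fun_cong[OF assms, of B] by (simp add: scaleR_fun_def power2_eq_square)
qed

lemma vee_square_eq_0_iff: "vee w w = 0 \<longleftrightarrow> w = 0"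
  for w :: "'a \<Rightarrow> real"
proof
  assume "vee w w = 0"
  then have "vee w w = 0 *\<^sub>R vee w w" by simp
  then have "(w f)\<^sup>2 = 0 * (w f)\<^sup>2" for f by (rule vee_square_values)
  then show "w = 0" by (auto simp: zero_fun_def)
next
  assume "w = 0"
  then show "vee w w = 0" using vee_square_scale[of 0 w] by simp
qed

lemma proj_point_scale: "a \<noteq> 0 \<Longrightarrow> proj_point (a *\<^sub>R u) = proj_point u"
  unfolding proj_point_def
proof (rule span_eq[THEN iffD2], safe)
  assume "a \<noteq> 0"
  show "a *\<^sub>R u \<in> span {u}" by (intro span_scale span_base) simp
  have "(1 / a) *\<^sub>R (a *\<^sub>R u) \<in> span {a *\<^sub>R u}" by (intro span_scale span_base) simp
  then show "u \<in> span {a *\<^sub>R u}" using \<open>a \<noteq> 0\<close> by simp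
qed

lemma proj_point_eqD: "proj_point u = proj_point v \<Longrightarrow> \<exists>a. u = a *\<^sub>R v"
  unfolding proj_point_def using span_base[of u "{u}"] span_singleton[of v] by auto

text \<open>If \<open>v\<close> lay in the first span but not in the second, a form \<open>g\<close>
  with \<open>g (v # ys) \<noteq> 0\<close>, contracted with \<open>v\<close>, would vanish at
  \<open>xs\<close> and not at \<open>ys\<close>. By \<open>vee_square_values\<close> this is
  impossible for proportional squares.\<close>

lemma span_eq_if_wedge_squares_eq:
  fixes xs ys :: "'v::real_vector list"
  assumes "length xs = length ys" "distinct xs" "independent (set xs)" "distinct ys" "independent (set ys)"
    and eq: "proj_point (vee (wedge xs) (wedge xs)) = proj_point (vee (wedge ys) (wedge ys))"
  shows "span (set xs) \<subseteq> span (set ys)"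
proof
  fix v assume v: "v \<in> span (set xs)"
  show "v \<in> span (set ys)"
  proof (rule ccontr)
    assume nv: "v \<notin> span (set ys)"
    then have "v \<notin> set ys" using span_base by blast
    then have "distinct (v # ys)" "independent (set (v # ys))"
      using assms(4,5) nv by (auto simp: independent_insert)
    then obtain g where g: "g \<in> alternating_forms (Suc (length ys))" "g (v # ys) \<noteq> 0"
      using alternating_form_nonzero[of "v # ys"] by auto
    have "\<not> (distinct (v # xs) \<and> independent (set (v # xs)))"
      using v by (auto simp: independent_insert)
    then have gxs: "g (v # xs) = 0"
      using alternating_nonzero_independent[of g "v # xs"] g(1) assms(1) by auto
    define f where "f zs = g (v # zs)" for zs
    have f: "f \<in> alternating_forms (length ys)"
      unfolding f_def using g(1) by (rule alternating_contraction)
    obtain K where "vee (wedge ys) (wedge ys) = K *\<^sub>R vee (wedge xs) (wedge xs)"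
      using proj_point_eqD[OF eq[symmetric]] by blast
    then have "(wedge ys f)\<^sup>2 = K * (wedge xs f)\<^sup>2" by (rule vee_square_values)
    then show False using f assms(1) gxs g(2) by (simp add: wedge_def f_def)
  qed
qed

theorem mainTheorem3:
  fixes e :: "nat \<Rightarrow> real ^ 'n" and n k :: nat
  assumes "n = CARD('n)" and "1 \<le> k" and "k \<le> n"
    and "inj_on e {1..n}" and "independent (e ` {1..n})" and "span (e ` {1..n}) = UNIV"
  shows
    "(\<exists>\<Phi>. (\<forall>xs. length xs = k \<and> distinct xs \<and> independent (set xs) \<longrightarrow>
              \<Phi> (span (set xs)) = proj_point (vee (wedge xs) (wedge xs))) \<and>
          bij_betw \<Phi> (grassmannian k) (relation_variety e n k)) \<and>
     (\<forall>(I, js, ps)\<in>bracket_relations n k.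
        is_linear_form (coord_indices n k) (\<lambda>q. bracket q I js ps)) \<and>
     (\<forall>\<alpha>\<in>index_tuples n k. \<forall>\<beta>\<in>index_tuples n k. \<alpha> \<noteq> \<beta> \<longrightarrow>
        is_quadratic_form_of_rank (coord_indices n k) (square_relation \<alpha> \<beta>) 3) \<and>
     (\<forall>\<alpha>\<in>index_tuples n k. \<forall>\<beta>\<in>index_tuples n k. \<forall>\<gamma>\<in>index_tuples n k.
        \<alpha> \<noteq> \<beta> \<and> \<alpha> \<noteq> \<gamma> \<and> \<beta> \<noteq> \<gamma> \<longrightarrow>
        is_quadratic_form_of_rank (coord_indices n k) (mixed_relation \<alpha> \<beta> \<gamma>) 4)"
proof (intro conjI)
  obtain c :: "nat \<Rightarrow> real ^ 'n \<Rightarrow> real" where c: "\<And>i. linear (c i)"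
    "\<And>i j. i \<in> {1..n} \<Longrightarrow> j \<in> {1..n} \<Longrightarrow> c i (e j) = of_bool (i = j)"
    using dual_functionals[OF assms(4,5)] by blast
  interpret dual_basis e c n
    by (rule dual_basis.intro[OF c assms(6)])
  define frame where "frame U xs \<longleftrightarrow> length xs = k \<and> distinct xs \<and> independent (set xs) \<and> span (set xs) = U"
    for U and xs :: "(real ^ 'n) list"
  define sq where "sq xs = proj_point (vee (wedge xs) (wedge xs))" for xs :: "(real ^ 'n) list"
  \<comment> \<open>An arbitrary ordered basis is chosen for each subspace; independence of the
    choice is the fact \<Phi> below.\<close>
  define \<Phi> where "\<Phi> U = sq (SOME xs. frame U xs)" for U
  have frame_ex: "\<exists>xs. frame U xs" if U: "U \<in> grassmannian k" for U
  proof -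
    obtain B where B: "B \<subseteq> U" "independent B" "U \<subseteq> span B" "card B = dim U" by (rule basis_exists)
    obtain xs where xs: "set xs = B" "distinct xs"
      using finite_distinct_list[OF finiteI_independent[OF B(2)]] by blast
    have "span B = U" using B(1,3) U by (simp add: grassmannian_def span_subspace)
    then show ?thesis
      using xs B U distinct_card[OF xs(2)] unfolding frame_def grassmannian_def by auto
  qed
  \<comment> \<open>Another basis multiplies the wedge product by some \<open>a \<noteq> 0\<close>,
    and its square by the nonzero factor \<open>a\<^sup>2\<close>, which leaves the projective point
    unchanged.\<close>
  have \<Phi>: "\<Phi> U = sq xs" if xs: "frame U xs" for U xs
  proof -
    define ys where "ys = (SOME xs. frame U xs)"
    have ys: "frame U ys" unfolding ys_def by (rule someI[of "frame U", OF xs])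
    have "set ys \<subseteq> span (set xs)" using xs ys span_superset unfolding frame_def by blast
    then obtain a where a: "wedge ys = a *\<^sub>R wedge xs"
      using wedge_proportional[of ys xs] xs ys unfolding frame_def by auto
    have "wedge ys \<noteq> 0" using ys wedge_nonzero_iff unfolding frame_def by blast
    then have "a \<noteq> 0" using a by auto
    then show ?thesis
      unfolding \<Phi>_def ys_def[symmetric] sq_def a vee_square_scale by (intro proj_point_scale) simp
  qed
  have inj: "inj_on \<Phi> (grassmannian k)"
  proof (rule inj_onI)
    fix U U' assume "U \<in> grassmannian k" "U' \<in> grassmannian k" and eq: "\<Phi> U = \<Phi> U'"
    then obtain xs ys where f: "frame U xs" "frame U' ys" using frame_ex by blast
    have sq: "sq xs = sq ys" using eq \<Phi>[OF f(1)] \<Phi>[OF f(2)] by simp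
    show "U = U'"
      using f span_eq_if_wedge_squares_eq[of xs ys] span_eq_if_wedge_squares_eq[of ys xs] sq
      unfolding frame_def sq_def by auto
  qed
  have into: "\<Phi> U \<in> relation_variety e n k" if "U \<in> grassmannian k" for U
  proof -
    from frame_ex[OF that] obtain xs where xs: "frame U xs" ..
    then have len: "length xs = k" and indep: "distinct xs" "independent (set xs)"
      unfolding frame_def by simp_all
    have "wedge xs \<in> ext_power k" unfolding ext_power_def
      by (rule span_base, rule CollectI, rule exI[of _ xs]) (simp add: len)
    then have "vee (wedge xs) (wedge xs) \<in> sym_square (ext_power k)"
      unfolding sym_square_def by (intro span_base CollectI exI[of _ "wedge xs"]) simp
    moreover have "vee (wedge xs) (wedge xs) \<noteq> 0"
      using indep by (simp add: vee_square_eq_0_iff wedge_nonzero_iff)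
    ultimately have "sq xs \<in> proj_space (sym_square (ext_power k))"
      unfolding proj_space_def sq_def by blast
    moreover have "sq xs = proj_point (vector_of_coords e n k (square_coords (\<lambda>\<alpha>. minor c \<alpha> xs)))"
      unfolding sq_def vee_square_coords[OF wedge_expansion[OF len]] ..
    ultimately show ?thesis
      unfolding relation_variety_def \<Phi>[OF xs] using satisfies_relations_minors[OF len] by blast
  qed
  have onto: "p \<in> \<Phi> ` grassmannian k" if "p \<in> relation_variety e n k" for p
  proof -
    from that obtain q where "p \<in> proj_space (sym_square (ext_power k))"
      and q: "p = proj_point (vector_of_coords e n k q)" "satisfies_relations n k q"
      unfolding relation_variety_def by blast
    then obtain u where u: "p = proj_point u" "u \<noteq> 0" unfolding proj_space_def by blast
    \<comment> \<open>The zero vector spans only the zero subspace, which is not a point of the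
      projective space.\<close>
    have nz: "vector_of_coords e n k q \<noteq> 0"
      using proj_point_eqD[of u "vector_of_coords e n k q"] u q(1) by auto
    obtain K xs where K: "K \<noteq> 0" "length xs = k"
      "vector_of_coords e n k q = K *\<^sub>R vee (wedge xs) (wedge xs)"
      using relations_imp_square[OF assms(2) q(2) nz] by blast
    have "wedge xs \<noteq> 0" using nz unfolding K(3) by (auto simp: vee_square_eq_0_iff)
    then have xs: "distinct xs" "independent (set xs)" using wedge_nonzero_iff by blast+
    then have f: "frame (span (set xs)) xs" using K(2) unfolding frame_def by blast
    have "p = \<Phi> (span (set xs))"
      unfolding q(1) K(3) \<Phi>[OF f] sq_def by (rule proj_point_scale[OF K(1)])
    moreover have "span (set xs) \<in> grassmannian k"
      using xs K(2) by (simp add: grassmannian_def dim_eq_card_independent distinct_card)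
    ultimately show ?thesis by blast
  qed
  have bij: "bij_betw \<Phi> (grassmannian k) (relation_variety e n k)"
  proof (rule bij_betw_imageI[OF inj])
    show "\<Phi> ` grassmannian k = relation_variety e n k"
      by (intro equalityI image_subsetI subsetI into onto)
  qed
  have "\<forall>xs. length xs = k \<and> distinct xs \<and> independent (set xs) \<longrightarrow>
      \<Phi> (span (set xs)) = proj_point (vee (wedge xs) (wedge xs))"
  proof (intro allI impI, elim conjE)
    fix xs :: "(real ^ 'n) list"
    assume "length xs = k" "distinct xs" "independent (set xs)"
    then have "frame (span (set xs)) xs" by (simp add: frame_def)
    from \<Phi>[OF this] show "\<Phi> (span (set xs)) = proj_point (vee (wedge xs) (wedge xs))"
      by (simp only: sq_def)
  qed
  with bij show "\<exists>\<Phi>. (\<forall>xs. length xs = k \<and> distinct xs \<and> independent (set xs) \<longrightarrow>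
              \<Phi> (span (set xs)) = proj_point (vee (wedge xs) (wedge xs))) \<and>
          bij_betw \<Phi> (grassmannian k) (relation_variety e n k)"
    by (intro exI[of _ \<Phi>] conjI)
next
  show "\<forall>(I, js, ps)\<in>bracket_relations n k. is_linear_form (coord_indices n k) (\<lambda>q. bracket q I js ps)"
    by (rule ballI, clarify, rule bracket_linear)
  show "\<forall>\<alpha>\<in>index_tuples n k. \<forall>\<beta>\<in>index_tuples n k. \<alpha> \<noteq> \<beta> \<longrightarrow>
        is_quadratic_form_of_rank (coord_indices n k) (square_relation \<alpha> \<beta>) 3"
    using square_relation_rank by blast
  show "\<forall>\<alpha>\<in>index_tuples n k. \<forall>\<beta>\<in>index_tuples n k. \<forall>\<gamma>\<in>index_tuples n k.
        \<alpha> \<noteq> \<beta> \<and> \<alpha> \<noteq> \<gamma> \<and> \<beta> \<noteq> \<gamma> \<longrightarrow>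
        is_quadratic_form_of_rank (coord_indices n k) (mixed_relation \<alpha> \<beta> \<gamma>) 4"
    using mixed_relation_rank by blast
qed

end
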